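(* Let $A$ be a strongly maximal TAF algebra with diagonal $D$ whose $C^*$-envelope $B$ is simple, and suppose that $A$ has totally ordered spectrum. Let $\pi$ be a continuous nest representation of $A$ on a Hilbert space $\mathcal{H}$. Then $\ker \pi$ is a meet irreducible ideal in $A$.
   Context: **AF algebra and canonical masa.** $B$ is an AF $C^*$-algebra and $D\subseteq B$ is a canonical masa: $B=\varinjlim(B_i,\phi_i)$ for finite dimensional $C^*$-algebras $B_i$ and embeddings $\phi_i\colon B_i\to B_{i+1}$, and $D=\varinjlim(D_i,\phi_i)$, where $D_i=D\cap B_i$ is a masa in $B_i$ and $\phi_i$ maps the normalizer of $D_i$ into the normalizer of $D_{i+1}$. A partial isometry $w\in B$ normalizes $D$ if $wDw^*\subseteq D$ and $w^*Dw\subseteq D$. **TAF algebras.** A TAF algebra with diagonal $D$ is a closed subalgebra $A$ with $D\subseteq A\subseteq B$ and $A\cap A^*=D$; then $A=\varinjlim(A_i,\phi_i)$ with $A_i=A\cap B_i$. It is strongly maximal if each $A_i$ is maximal triangular in $B_i$ with diagonal $D_i$; this is equivalent to $A+A^*$ being dense in $B$. **Spectrum.** $X$ is the spectrum of $D$, so $D\cong C(X)$; $X$ is a Cantor space. Each $D$-normalizing partial isometry $v\in B$ induces a homeomorphism $\alpha_v$ from the clopen support of $v^*v$ onto the clopen support of $vv^*$, determined by $(vdv^* )(\alpha_v(x))=d(x)$ for $d\in D$ and $x$ in the support of $v^*v$. Put $\hat v=\{(\alpha_v(x),x)\}$. The union $G$ of the sets $\hat v$ over all $D$-normalizing partial isometries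 $v\in B$ is an equivalence relation on $X$; its classes are called orbits. The spectrum $P$ of $A$ is the union of the sets $\hat v$ over the $D$-normalizing partial isometries $v\in A$. When $A$ is strongly maximal, the relation $x\preceq y \iff (x,y)\in P$ is a total order on each orbit. **Totally ordered spectrum.** $A$ has totally ordered spectrum if there is a total order $\preceq$ on $X$ which agrees on each orbit (equivalence class of $G$) with the total order induced by $P$. In this setting $X$ has a minimal and a maximal element, denoted $0$ and $1$. **Nest representations and meet irreducibility.** A nest representation of $A$ is a continuous algebra homomorphism $\pi\colon A\to\mathcal{B}(\mathcal{H})$, $\mathcal{H}$ a Hilbert space, such that the lattice $\operatorname{Lat}\pi(A)$ of closed $\pi(A)$-invariant subspaces (identified with their orthogonal projections) is totally ordered by inclusion. Ideals are closed and two-sided. An ideal $\mathcal{I}$ of $A$ is meet irreducible if, for all ideals $\mathcal{J},\mathcal{K}$ of $A$, $\mathcal{I}=\mathcal{J}\cap\mathcal{K}$ implies $\mathcal{I}=\mathcal{J}$ or $\mathcal{I}=\mathcal{K}$. *)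

theory Defs
  imports "HOL-Analysis.Analysis"
begin

section \<open>Complex normed spaces, C*-algebras and Hilbert spaces\<close>

class complex_vector = real_vector +
  fixes scaleC :: "complex \<Rightarrow> 'a \<Rightarrow> 'a"  (infixr \<open>*\<^sub>C\<close> 75)
  assumes scaleC_add_right: "c *\<^sub>C (x + y) = c *\<^sub>C x + c *\<^sub>C y"
    and scaleC_add_left: "(c + d) *\<^sub>C x = c *\<^sub>C x + d *\<^sub>C x"
    and scaleC_scaleC: "c *\<^sub>C (d *\<^sub>C x) = (c * d) *\<^sub>C x"
    and scaleR_scaleC: "r *\<^sub>R x = complex_of_real r *\<^sub>C x"

global_interpretation complex_vector:
  vector_space "scaleC :: complex \<Rightarrow> 'a \<Rightarrow> 'a :: complex_vector"
proof
  show "1 *\<^sub>C x = x" for x :: 'a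
    by (metis of_real_1 scaleR_one scaleR_scaleC)
qed (simp_all add: scaleC_add_right scaleC_add_left scaleC_scaleC)

class complex_normed_vector = complex_vector + real_normed_vector +
  assumes norm_scaleC: "norm (c *\<^sub>C x) = cmod c * norm x"

text \<open>C*-algebras are not assumed to have a unit.\<close>

class cstar_algebra = complex_normed_vector + real_normed_algebra + banach +
  fixes adj :: "'a \<Rightarrow> 'a"
  assumes mult_scaleC_left: "(c *\<^sub>C x) * y = c *\<^sub>C (x * y)"
    and mult_scaleC_right: "x * (c *\<^sub>C y) = c *\<^sub>C (x * y)"
    and adj_add: "adj (x + y) = adj x + adj y"
    and adj_scaleC: "adj (c *\<^sub>C x) = cnj c *\<^sub>C adj x"
    and adj_mult: "adj (x * y) = adj y * adj x"
    and adj_adj: "adj (adj x) = x"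
    and cstar_identity: "norm (adj x * x) = (norm x)\<^sup>2"

class chilbert_space = complex_normed_vector + banach +
  fixes cinner :: "'a \<Rightarrow> 'a \<Rightarrow> complex"
  assumes cinner_add_left: "cinner (x + y) z = cinner x z + cinner y z"
    and cinner_scaleC_left: "cinner (c *\<^sub>C x) y = c * cinner x y"
    and cinner_commute: "cinner x y = cnj (cinner y x)"
    and cinner_self: "cinner x x = complex_of_real ((norm x)\<^sup>2)"


section \<open>Subalgebras, ideals and masas\<close>

definition subalgebra :: "'b::cstar_algebra set \<Rightarrow> bool" where
  "subalgebra S \<longleftrightarrow> complex_vector.subspace S \<and> (\<forall>a\<in>S. \<forall>b\<in>S. a * b \<in> S)"

definition star_subalgebra :: "'b::cstar_algebra set \<Rightarrow> bool" where
  "star_subalgebra S \<longleftrightarrow> subalgebra S \<and> (\<forall>a\<in>S. adj a \<in> S)"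

definition finite_dimensional :: "'a::complex_vector set \<Rightarrow> bool" where
  "finite_dimensional S \<longleftrightarrow> (\<exists>F. finite F \<and> S = complex_vector.span F)"

definition closed_ideal :: "'b::cstar_algebra set \<Rightarrow> 'b set \<Rightarrow> bool" where
  "closed_ideal A J \<longleftrightarrow> J \<subseteq> A \<and> complex_vector.subspace J \<and> closed J \<and>
     (\<forall>a\<in>A. \<forall>x\<in>J. a * x \<in> J \<and> x * a \<in> J)"

definition meet_irreducible :: "'b::cstar_algebra set \<Rightarrow> 'b set \<Rightarrow> bool" where
  "meet_irreducible A I \<longleftrightarrow> closed_ideal A I \<and>
     (\<forall>J K. closed_ideal A J \<and> closed_ideal A K \<and> I = J \<inter> K \<longrightarrow> I = J \<or> I = K)"

definition simple_cstar :: "'b::cstar_algebra itself \<Rightarrow> bool" where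
  "simple_cstar _ \<longleftrightarrow> (UNIV :: 'b set) \<noteq> {0} \<and>
     (\<forall>J :: 'b set. closed_ideal UNIV J \<longrightarrow> J = {0} \<or> J = UNIV)"

definition abelian_star_subalgebra :: "'b::cstar_algebra set \<Rightarrow> bool" where
  "abelian_star_subalgebra S \<longleftrightarrow> star_subalgebra S \<and> (\<forall>a\<in>S. \<forall>b\<in>S. a * b = b * a)"

definition masa :: "'b::cstar_algebra set \<Rightarrow> 'b set \<Rightarrow> bool" where
  "masa B D \<longleftrightarrow> D \<subseteq> B \<and> abelian_star_subalgebra D \<and>
     (\<forall>E. abelian_star_subalgebra E \<and> D \<subseteq> E \<and> E \<subseteq> B \<longrightarrow> E = D)"

definition partial_isometry :: "'b::cstar_algebra \<Rightarrow> bool" where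
  "partial_isometry w \<longleftrightarrow> w * adj w * w = w"

definition normalizer :: "'b::cstar_algebra set \<Rightarrow> 'b set \<Rightarrow> 'b set" where
  "normalizer B D = {w\<in>B. partial_isometry w \<and>
     (\<forall>d\<in>D. w * d * adj w \<in> D) \<and> (\<forall>d\<in>D. adj w * d * w \<in> D)}"


section \<open>AF algebras with a canonical masa, and TAF algebras\<close>

text \<open>
  The AF algebra is the whole type. As the connecting maps of the inductive system are
  injective, the finite dimensional algebras are taken to be an increasing sequence of
  subalgebras \<open>Bs i\<close> with dense union.
\<close>

definition AF_canonical_masa :: "(nat \<Rightarrow> 'b::cstar_algebra set) \<Rightarrow> 'b set \<Rightarrow> bool" where
  "AF_canonical_masa Bs D \<longleftrightarrow>
     (\<forall>i. star_subalgebra (Bs i) \<and> finite_dimensional (Bs i) \<and> Bs i \<subseteq> Bs (Suc i)) \<and>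
     closure (\<Union>i. Bs i) = UNIV \<and>
     masa UNIV D \<and>
     (\<forall>i. masa (Bs i) (D \<inter> Bs i)) \<and>
     closure (\<Union>i. D \<inter> Bs i) = D \<and>
     (\<forall>i. normalizer (Bs i) (D \<inter> Bs i) \<subseteq> normalizer (Bs (Suc i)) (D \<inter> Bs (Suc i)))"

definition triangular :: "'b::cstar_algebra set \<Rightarrow> 'b set \<Rightarrow> bool" where
  "triangular D A \<longleftrightarrow> subalgebra A \<and> A \<inter> adj ` A = D"

definition TAF_algebra :: "'b::cstar_algebra set \<Rightarrow> 'b set \<Rightarrow> bool" where
  "TAF_algebra D A \<longleftrightarrow> triangular D A \<and> closed A"

definition maximal_triangular :: "'b::cstar_algebra set \<Rightarrow> 'b set \<Rightarrow> 'b set \<Rightarrow> bool" where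
  "maximal_triangular B D T \<longleftrightarrow> T \<subseteq> B \<and> triangular D T \<and>
     (\<forall>S. S \<subseteq> B \<and> triangular D S \<and> T \<subseteq> S \<longrightarrow> S = T)"

definition strongly_maximal ::
    "(nat \<Rightarrow> 'b::cstar_algebra set) \<Rightarrow> 'b set \<Rightarrow> 'b set \<Rightarrow> bool" where
  "strongly_maximal Bs D A \<longleftrightarrow> (\<forall>i. maximal_triangular (Bs i) (D \<inter> Bs i) (A \<inter> Bs i))"


section \<open>The spectrum\<close>

text \<open>
  Points of the spectrum are the nonzero multiplicative linear functionals on \<open>D\<close>, made
  \<^const>\<open>extensional\<close> so that they are determined by their values on \<open>D\<close>; the topology is that
  of pointwise convergence on \<open>D\<close>. Thus \<open>d(x)\<close> is written \<open>x d\<close>.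
\<close>

definition spectrum :: "'b::cstar_algebra set \<Rightarrow> ('b \<Rightarrow> complex) set" where
  "spectrum D = {x \<in> extensional D.
     (\<forall>a\<in>D. \<forall>b\<in>D. x (a + b) = x a + x b \<and> x (a * b) = x a * x b) \<and>
     (\<forall>c. \<forall>a\<in>D. x (c *\<^sub>C a) = c * x a) \<and>
     (\<exists>a\<in>D. x a \<noteq> 0)}"

definition spectrum_topology :: "'b::cstar_algebra set \<Rightarrow> ('b \<Rightarrow> complex) topology" where
  "spectrum_topology D = subtopology (product_topology (\<lambda>_. euclidean) D) (spectrum D)"

definition cantor_space :: "'a topology \<Rightarrow> bool" where
  "cantor_space X \<longleftrightarrow>
     X homeomorphic_space product_topology (\<lambda>_::nat. discrete_topology (UNIV::bool set)) UNIV"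

text \<open>
  \<open>(y, x) \<in> hat D v\<close> means that \<open>x\<close> lies in the support of \<open>v\<^sup>*v\<close> and \<open>y = \<alpha>\<^sub>v(x)\<close>. The
  defining equation determines \<open>y\<close> and puts it in the support of \<open>vv\<^sup>*\<close>.
\<close>

definition hat :: "'b::cstar_algebra set \<Rightarrow> 'b \<Rightarrow> (('b \<Rightarrow> complex) \<times> ('b \<Rightarrow> complex)) set" where
  "hat D v = {(y, x). x \<in> spectrum D \<and> y \<in> spectrum D \<and> x (adj v * v) \<noteq> 0 \<and>
     (\<forall>d\<in>D. y (v * d * adj v) = x d)}"

text \<open>
  For \<open>A = UNIV\<close> this is the equivalence relation \<open>G\<close>; for a TAF algebra \<open>A\<close> it is \<open>P\<close>.
\<close>

definition spectral_relation ::
    "'b::cstar_algebra set \<Rightarrow> 'b set \<Rightarrow> (('b \<Rightarrow> complex) \<times> ('b \<Rightarrow> complex)) set" where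
  "spectral_relation D A = (\<Union>v \<in> normalizer UNIV D \<inter> A. hat D v)"

text \<open>
  The total order is a bare order on the point set: no relation to the topology is required.
\<close>

definition totally_ordered_spectrum :: "'b::cstar_algebra set \<Rightarrow> 'b set \<Rightarrow> bool" where
  "totally_ordered_spectrum D A \<longleftrightarrow>
     (\<exists>R. linear_order_on (spectrum D) R \<and>
       (\<forall>(x, y) \<in> spectral_relation D UNIV. (x, y) \<in> R \<longleftrightarrow> (x, y) \<in> spectral_relation D A))"


section \<open>Nest representations\<close>

text \<open>
  \<open>'h \<Rightarrow>\<^sub>L 'h\<close> consists of the bounded real-linear operators with the operator norm;
  complex linearity of the operators in the range is required separately.
\<close>

definition continuous_representation ::
    "'b::cstar_algebra set \<Rightarrow> ('b \<Rightarrow> 'h::chilbert_space \<Rightarrow>\<^sub>L 'h) \<Rightarrow> bool" where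
  "continuous_representation A \<pi> \<longleftrightarrow>
     (\<forall>a\<in>A. \<forall>c h. blinfun_apply (\<pi> a) (c *\<^sub>C h) = c *\<^sub>C blinfun_apply (\<pi> a) h) \<and>
     (\<forall>a\<in>A. \<forall>b\<in>A. \<pi> (a + b) = \<pi> a + \<pi> b) \<and>
     (\<forall>a\<in>A. \<forall>c h. blinfun_apply (\<pi> (c *\<^sub>C a)) h = c *\<^sub>C blinfun_apply (\<pi> a) h) \<and>
     (\<forall>a\<in>A. \<forall>b\<in>A. \<pi> (a * b) = \<pi> a o\<^sub>L \<pi> b) \<and>
     continuous_on A \<pi>"

definition Lat :: "('h::chilbert_space \<Rightarrow>\<^sub>L 'h) set \<Rightarrow> 'h set set" where
  "Lat S = {M. complex_vector.subspace M \<and> closed M \<and> (\<forall>T\<in>S. blinfun_apply T ` M \<subseteq> M)}"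

definition nest_representation ::
    "'b::cstar_algebra set \<Rightarrow> ('b \<Rightarrow> 'h::chilbert_space \<Rightarrow>\<^sub>L 'h) \<Rightarrow> bool" where
  "nest_representation A \<pi> \<longleftrightarrow> continuous_representation A \<pi> \<and>
     (\<forall>M \<in> Lat (\<pi> ` A). \<forall>N \<in> Lat (\<pi> ` A). M \<subseteq> N \<or> N \<subseteq> M)"

definition rep_kernel ::
    "'b::cstar_algebra set \<Rightarrow> ('b \<Rightarrow> 'h::chilbert_space \<Rightarrow>\<^sub>L 'h) \<Rightarrow> 'b set" where
  "rep_kernel A \<pi> = {a\<in>A. \<pi> a = 0}"

end

theory Submission
  imports Defs "HOL-Computational_Algebra.Fundamental_Theorem_Algebra"
begin

text \<open>
  Suppose that \<open>ker \<pi> = J \<inter> K\<close> with ideals \<open>J\<close> and \<open>K\<close> that both exceed the kernel. As ideals are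
  inductive (\<open>closed_bimodule_inductive\<close>), some \<open>e \<in> J\<close> and \<open>f \<in> K\<close> outside the kernel lie in a
  common finite dimensional algebra \<open>Bs i\<close>. The closed spans of \<open>\<pi>(Ae)H\<close> and \<open>\<pi>(Af)H\<close> are invariant
  subspaces, hence comparable; say that the first contains the second, and with it the range of
  \<open>\<pi> f\<close>.

  For upper triangular matrices and matrix units \<open>e = e\<^sub>a\<^sub>b\<close> and \<open>f = e\<^sub>c\<^sub>d\<close> this says \<open>c \<le> a\<close> and
  \<open>\<pi> (e\<^sub>c\<^sub>b) \<noteq> 0\<close>, where \<open>e\<^sub>c\<^sub>b = e\<^sub>c\<^sub>a e \<in> J\<close>. If \<open>d \<le> b\<close> then \<open>e\<^sub>c\<^sub>b = f e\<^sub>d\<^sub>b\<close> is also in \<open>K\<close>; otherwise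
  \<open>f = e\<^sub>c\<^sub>b e\<^sub>b\<^sub>d\<close> is also in \<open>J\<close>. Either way \<open>J \<inter> K\<close> has an element outside the kernel, a
  contradiction. In general the range of \<open>\<pi> f\<close> is only approximated by \<open>\<pi>(xe)H\<close> with \<open>x\<close> in larger and
  larger \<open>Bs j\<close>, so that \<open>e\<close>, \<open>f\<close> and \<open>x\<close> are decomposed into entries \<open>p x q\<close> over the minimal
  projections of \<open>D \<inter> Bs j\<close>. Rows of \<open>f\<close> whose entries all lie in the kernel are cut off by a projection,
  and as \<open>\<pi>\<close> is bounded this cutting is uniform in \<open>j\<close>; the matrix argument then applies to single
  entries (\<open>range_not_in_cyclic_subspace\<close>).

  Three facts about the finite dimensional levels carry this. Entries between two minimal projections
  form a space of dimension at most one, because the corners \<open>p (Bs j) p\<close> are scalar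
  (\<open>masa_diagonal_frame\<close>). The alternative \<open>d \<le> b\<close> or \<open>b \<le> d\<close> is
  \<open>maximal_triangular_comparable\<close>, which uses the maximality of \<open>A \<inter> Bs j\<close>. Finally, closed
  \<open>D\<close>-bimodules are the closures of their intersections with \<open>\<Union>j. Bs j\<close>; this is applied to \<open>A\<close>, \<open>J\<close>
  and \<open>K\<close>.
\<close>

section \<open>C*-algebra preliminaries\<close>

lemma adj_zero [simp]: "adj (0::'b::cstar_algebra) = 0"
  using adj_add[of "0::'b" 0] by simp

lemma adj_minus: "adj (- x :: 'b::cstar_algebra) = - adj x"
  using adj_add[of x "- x"] by (simp add: add_eq_0_iff2)

lemma adj_diff: "adj (x - y :: 'b::cstar_algebra) = adj x - adj y"
  using adj_add[of x "- y"] by (simp add: adj_minus)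

lemma adj_sum: "adj (sum f S :: 'b::cstar_algebra) = (\<Sum>x\<in>S. adj (f x))"
  by (induction S rule: infinite_finite_induct) (auto simp: adj_add)

lemma norm_adj: "norm (adj x) = norm (x :: 'b::cstar_algebra)"
proof -
  have le: "norm y \<le> norm (adj y)" for y :: 'b
  proof (cases "norm y = 0")
    case False
    have "norm y * norm y \<le> norm (adj y) * norm y"
      using norm_mult_ineq[of "adj y" y] by (simp add: cstar_identity power2_eq_square)
    then show ?thesis using False by simp
  qed simp
  show ?thesis using le[of x] le[of "adj x"] by (simp add: adj_adj)
qed

lemma adj_mult_self_eq_0: "adj x * x = 0 \<longleftrightarrow> x = (0 :: 'b::cstar_algebra)"
  using cstar_identity[of x] by auto

lemma mult_adj_self_eq_0: "x * adj x = 0 \<longleftrightarrow> x = (0 :: 'b::cstar_algebra)"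
  using adj_mult_self_eq_0[of "adj x"] by (metis adj_adj adj_zero)

lemma scaleC_of_real: "complex_of_real r *\<^sub>C x = r *\<^sub>R (x :: 'b::complex_vector)"
  by (simp add: scaleR_scaleC)

lemma adj_scaleR: "adj (r *\<^sub>R x) = r *\<^sub>R adj (x :: 'b::cstar_algebra)"
  by (simp add: scaleR_scaleC adj_scaleC)

lemma linear_mult_left:
  "Vector_Spaces.linear scaleC scaleC (\<lambda>x. y * x :: 'b::cstar_algebra)"
  by unfold_locales (simp_all add: distrib_left mult_scaleC_right)

definition projection :: "'b::cstar_algebra \<Rightarrow> bool" where
  "projection p \<longleftrightarrow> adj p = p \<and> p * p = p"

definition orthogonal_projections :: "'b::cstar_algebra set \<Rightarrow> bool" where
  "orthogonal_projections F \<longleftrightarrow> finite F \<and> (\<forall>p\<in>F. projection p) \<and>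
     (\<forall>p\<in>F. \<forall>q\<in>F. p \<noteq> q \<longrightarrow> p * q = 0)"

lemma orthogonal_projections_subset:
  "orthogonal_projections F \<Longrightarrow> E \<subseteq> F \<Longrightarrow> orthogonal_projections E"
  by (auto simp: orthogonal_projections_def finite_subset subset_iff)

lemma sum_mult_orthogonal:
  assumes "orthogonal_projections F" "q \<in> F"
  shows "(\<Sum>p\<in>F. c p *\<^sub>C p) * q = c q *\<^sub>C q" "q * (\<Sum>p\<in>F. c p *\<^sub>C p) = c q *\<^sub>C q"
proof -
  have c: "c p *\<^sub>C (p * q) = (if p = q then c q *\<^sub>C q else 0)"
    "c p *\<^sub>C (q * p) = (if p = q then c q *\<^sub>C q else 0)" if "p \<in> F" for p
    using assms that by (auto simp: orthogonal_projections_def projection_def)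
  have 1: "(\<Sum>p\<in>F. c p *\<^sub>C (p * q)) = (\<Sum>p\<in>F. if p = q then c q *\<^sub>C q else 0)"
    and 2: "(\<Sum>p\<in>F. c p *\<^sub>C (q * p)) = (\<Sum>p\<in>F. if p = q then c q *\<^sub>C q else 0)"
    using c by (auto intro!: sum.cong)
  show "(\<Sum>p\<in>F. c p *\<^sub>C p) * q = c q *\<^sub>C q"
    using 1 assms by (simp add: sum_distrib_right mult_scaleC_left orthogonal_projections_def)
  show "q * (\<Sum>p\<in>F. c p *\<^sub>C p) = c q *\<^sub>C q"
    using 2 assms by (simp add: sum_distrib_left mult_scaleC_right orthogonal_projections_def)
qed

lemma sum_orthogonal_mult:
  assumes "orthogonal_projections F" "q \<in> F"
  shows "\<Sum>F * q = q" "q * \<Sum>F = q"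
  using sum_mult_orthogonal[OF assms, of "\<lambda>_. 1"] by simp_all

lemma projection_sum_orthogonal:
  assumes "orthogonal_projections F" shows "projection (\<Sum>F)"
proof -
  have "adj (\<Sum>F) = \<Sum>F"
    using assms by (simp add: adj_sum orthogonal_projections_def projection_def)
  moreover have "\<Sum>F * \<Sum>F = \<Sum>F"
  proof -
    have "\<Sum>F * \<Sum>F = (\<Sum>q\<in>F. \<Sum>F * q)" by (simp add: sum_distrib_left)
    also have "\<dots> = \<Sum>F" using assms by (simp add: sum_orthogonal_mult)
    finally show ?thesis .
  qed
  ultimately show ?thesis by (simp add: projection_def)
qed

lemma norm_partial_isometry_le_1:
  assumes "partial_isometry (w :: 'b::cstar_algebra)" shows "norm w \<le> 1"
proof -
  have "(adj w * w) * (adj w * w) = adj w * w"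
    using assms by (simp add: partial_isometry_def mult.assoc)
  moreover have "adj (adj w * w) = adj w * w" by (simp add: adj_mult adj_adj)
  ultimately have "(norm (adj w * w))\<^sup>2 = norm (adj w * w)"
    by (metis cstar_identity)
  then have "norm (adj w * w) \<le> 1" by (metis dual_order.refl mult_cancel_right1 norm_ge_zero
        power2_eq_square zero_le_one)
  then show ?thesis by (simp add: cstar_identity power2_le_iff_abs_le abs_le_square_iff[symmetric] power_le_one_iff)
qed

lemma projection_imp_partial_isometry: "projection p \<Longrightarrow> partial_isometry p"
  by (simp add: projection_def partial_isometry_def)

lemma norm_projection_le_1: "projection p \<Longrightarrow> norm p \<le> 1"
  by (simp add: norm_partial_isometry_le_1 projection_imp_partial_isometry)

lemma symmetry_extend:
  assumes "adj y = y" "y * y * y = (y::'b::cstar_algebra)" "projection r" "y * r = 0"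
  shows "adj (y + r) = y + r" "(y + r) * (y + r) * (y + r) = y + r"
    "adj (y - r) = y - r" "(y - r) * (y - r) * (y - r) = y - r" "r * y = 0"
proof -
  show ry: "r * y = 0"
    using assms by (metis adj_mult adj_zero projection_def)
  have [simp]: "y * y * r = 0" "r * r = r" "adj r = r"
    using assms by (auto simp: projection_def mult.assoc)
  show "adj (y + r) = y + r" "adj (y - r) = y - r"
    using assms by (simp_all add: adj_add adj_diff)
  show "(y + r) * (y + r) * (y + r) = y + r" "(y - r) * (y - r) * (y - r) = y - r"
    using assms ry by (simp_all add: algebra_simps)
qed

lemma norm_symmetry_le_1:
  assumes "adj y = y" "y * y * y = (y::'b::cstar_algebra)" shows "norm y \<le> 1"
  using assms by (intro norm_partial_isometry_le_1) (simp add: partial_isometry_def)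

text \<open>
  A pinching is an average of the maps \<open>a \<mapsto> u * a * u\<close>, where \<open>u\<close> runs over the self-adjoint
  partial isometries \<open>\<Sum>\<plusminus>r\<close>. The auxiliary \<open>y\<close> collects the summands of \<open>u\<close> whose sign
  has already been chosen.
\<close>

lemma norm_pinching_aux:
  fixes a :: "'b::cstar_algebra"
  assumes "finite F"
  shows "orthogonal_projections F \<Longrightarrow> adj y = y \<Longrightarrow> y * y * y = y \<Longrightarrow> (\<forall>r\<in>F. y * r = 0) \<Longrightarrow>
    norm (y * a * y + (\<Sum>r\<in>F. r * a * r)) \<le> norm a"
  using assms
proof (induction F arbitrary: y)
  case empty
  have "norm (y * a * y) \<le> norm y * norm a * norm y"
    by (meson mult_right_mono norm_ge_zero norm_mult_ineq order_trans)
  also have "\<dots> \<le> 1 * norm a * 1"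
    using norm_symmetry_le_1[OF empty(2,3)] by (intro mult_mono) auto
  finally show ?case by simp
next
  case (insert r F)
  have r: "projection r" "y * r = 0" and F: "orthogonal_projections F"
    and rF: "\<forall>s\<in>F. r * s = 0"
    using insert by (auto simp: orthogonal_projections_def)
  note e = symmetry_extend[OF insert.prems(2,3) r]
  let ?S = "\<Sum>r\<in>F. r * a * r"
  have 1: "norm ((y + r) * a * (y + r) + ?S) \<le> norm a"
    using insert.prems rF by (intro insert.IH F e) (auto simp: distrib_right)
  have 2: "norm ((y - r) * a * (y - r) + ?S) \<le> norm a"
    using insert.prems rF by (intro insert.IH F e) (auto simp: left_diff_distrib)
  have "2 *\<^sub>R (y * a * y + (r * a * r + ?S)) =
      ((y + r) * a * (y + r) + ?S) + ((y - r) * a * (y - r) + ?S)"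
    by (simp add: algebra_simps scaleR_2)
  moreover have "norm (((y + r) * a * (y + r) + ?S) + ((y - r) * a * (y - r) + ?S)) \<le> norm a + norm a"
    by (rule norm_triangle_mono[OF 1 2])
  ultimately have "norm (2 *\<^sub>R (y * a * y + (r * a * r + ?S))) \<le> norm a + norm a"
    by simp
  then show ?case using insert by simp
qed

lemma norm_pinching_le:
  assumes "orthogonal_projections F"
  shows "norm (\<Sum>r\<in>F. r * a * r) \<le> norm (a :: 'b::cstar_algebra)"
  using norm_pinching_aux[of F 0 a] assms by (simp add: orthogonal_projections_def)

text \<open>
  The coefficients in \<open>[-1, 1]\<close> are averages of signs, so the same induction on \<open>F\<close> bounds the norm by
  that of the self-adjoint partial isometries \<open>\<Sum>\<plusminus>r\<close>.
\<close>

lemma norm_diagonal_aux: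
  fixes y :: "'b::cstar_algebra"
  assumes "finite F"
  shows "orthogonal_projections F \<Longrightarrow> adj y = y \<Longrightarrow> y * y * y = y \<Longrightarrow> (\<forall>r\<in>F. y * r = 0) \<Longrightarrow>
    (\<forall>r\<in>F. \<bar>\<nu> r\<bar> \<le> 1) \<Longrightarrow> norm (y + (\<Sum>r\<in>F. \<nu> r *\<^sub>R r)) \<le> 1"
  using assms
proof (induction F arbitrary: y)
  case empty
  then show ?case by (simp add: norm_symmetry_le_1)
next
  case (insert r F)
  have r: "projection r" "y * r = 0" and F: "orthogonal_projections F"
    and rF: "\<forall>s\<in>F. r * s = 0"
    using insert by (auto simp: orthogonal_projections_def)
  note e = symmetry_extend[OF insert.prems(2,3) r]
  let ?S = "\<Sum>r\<in>F. \<nu> r *\<^sub>R r"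
  have 1: "norm ((y + r) + ?S) \<le> 1"
    using insert.prems rF by (intro insert.IH F e) (auto simp: distrib_right)
  have 2: "norm ((y - r) + ?S) \<le> 1"
    using insert.prems rF by (intro insert.IH F e) (auto simp: left_diff_distrib)
  let ?n = "\<nu> r"
  have "\<bar>?n\<bar> \<le> 1" using insert.prems(5) by blast
  then have n: "1 + ?n \<ge> 0" "1 - ?n \<ge> 0" by linarith+
  have "2 *\<^sub>R (y + (?n *\<^sub>R r + ?S)) =
      (1 + ?n) *\<^sub>R ((y + r) + ?S) + (1 - ?n) *\<^sub>R ((y - r) + ?S)"
    by (simp add: algebra_simps scaleR_2 del: scaleR_scaleR)
  then have "norm (2 *\<^sub>R (y + (?n *\<^sub>R r + ?S))) \<le>
      norm ((1 + ?n) *\<^sub>R ((y + r) + ?S)) + norm ((1 - ?n) *\<^sub>R ((y - r) + ?S))"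
    by (simp only: norm_triangle_ineq)
  then have "2 * norm (y + (?n *\<^sub>R r + ?S)) \<le>
      (1 + ?n) * norm ((y + r) + ?S) + (1 - ?n) * norm ((y - r) + ?S)"
    using n by simp
  also have "\<dots> \<le> (1 + ?n) * 1 + (1 - ?n) * 1"
    using 1 2 n by (intro add_mono mult_left_mono) auto
  finally show ?case using insert by simp
qed

lemma norm_diagonal_le:
  fixes F :: "'b::cstar_algebra set"
  assumes F: "orthogonal_projections F" and M: "\<And>r. r \<in> F \<Longrightarrow> cmod (\<mu> r) \<le> M" "M \<ge> 0"
  shows "norm (\<Sum>r\<in>F. \<mu> r *\<^sub>C r) \<le> M"
proof (cases "M = 0")
  case True
  then show ?thesis using M by simp
next
  case False
  let ?x = "\<Sum>r\<in>F. \<mu> r *\<^sub>C r"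
  let ?\<nu> = "\<lambda>r. (cmod (\<mu> r) / M)\<^sup>2"
  have pr: "r * r = r" "adj r = r" if "r \<in> F" for r
    using F that by (auto simp: orthogonal_projections_def projection_def)
  have "adj ?x * ?x = (\<Sum>r\<in>F. cnj (\<mu> r) *\<^sub>C (r * ?x))"
    by (simp add: adj_sum adj_scaleC sum_distrib_right mult_scaleC_left pr)
  also have "\<dots> = (\<Sum>r\<in>F. (M\<^sup>2 * ?\<nu> r) *\<^sub>R r)"
  proof (rule sum.cong)
    fix r assume r: "r \<in> F"
    have "cnj (\<mu> r) * \<mu> r = complex_of_real (M\<^sup>2 * ?\<nu> r)"
      using False complex_mod_mult_cnj[of "\<mu> r"] complex_norm_square[of "\<mu> r"] by (simp add: mult.commute power_divide)
    then show "cnj (\<mu> r) *\<^sub>C (r * ?x) = (M\<^sup>2 * ?\<nu> r) *\<^sub>R r"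
      using sum_mult_orthogonal(2)[OF F r, of \<mu>] by (simp add: scaleC_scaleC scaleR_scaleC)
  qed simp
  also have "\<dots> = M\<^sup>2 *\<^sub>R (0 + (\<Sum>r\<in>F. ?\<nu> r *\<^sub>R r))" by (simp add: scaleR_sum_right)
  finally have *: "adj ?x * ?x = M\<^sup>2 *\<^sub>R (0 + (\<Sum>r\<in>F. ?\<nu> r *\<^sub>R r))" .
  have "norm (0 + (\<Sum>r\<in>F. ?\<nu> r *\<^sub>R r)) \<le> 1"
  proof (rule norm_diagonal_aux)
    show "\<forall>r\<in>F. \<bar>?\<nu> r\<bar> \<le> 1"
      using M False by (auto simp: power_le_one_iff abs_square_le_1)
  qed (use F in \<open>auto simp: orthogonal_projections_def\<close>)
  then have "(norm ?x)\<^sup>2 \<le> M\<^sup>2"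
    unfolding cstar_identity[symmetric] * by (simp add: mult_left_le)
  then show ?thesis using M(2) by (rule power2_le_imp_le)
qed

section \<open>Finite dimensional abelian subalgebras\<close>

lemma injective_imp_surjective_on_subspace:
  fixes L :: "'b::complex_vector \<Rightarrow> 'b"
  assumes V: "complex_vector.subspace V" "V \<subseteq> complex_vector.span F" "finite F"
    and L: "Vector_Spaces.linear scaleC scaleC L" "L ` V \<subseteq> V" "\<And>v. v \<in> V \<Longrightarrow> L v = 0 \<Longrightarrow> v = 0"
  shows "L ` V = V"
proof -
  interpret L: Vector_Spaces.linear scaleC scaleC L by (rule L(1))
  obtain S where S: "S \<subseteq> V" "complex_vector.independent S" "V \<subseteq> complex_vector.span S"
    using complex_vector.maximal_independent_subset by metis
  have spanS: "complex_vector.span S = V"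
    using S V by (simp add: complex_vector.span_subspace)
  have finS: "finite S"
    using complex_vector.independent_span_bound[OF V(3) S(2)] S(1) V(2) by auto
  have inj: "inj_on L V"
    unfolding L.inj_on_iff_eq_0[OF V(1)] using L(3) by blast
  have ind: "complex_vector.independent (L ` S)"
    by (rule L.independent_injective_image) (use S(2) inj spanS in auto)
  have "V \<subseteq> complex_vector.span (L ` S)"
  proof
    fix v assume v: "v \<in> V"
    show "v \<in> complex_vector.span (L ` S)"
    proof (rule ccontr)
      assume nv: "v \<notin> complex_vector.span (L ` S)"
      then have "complex_vector.independent (insert v (L ` S))"
        by (rule complex_vector.independent_insertI[OF _ ind])
      then have "card (insert v (L ` S)) \<le> card S"
        using complex_vector.independent_span_bound[OF finS, of "insert v (L ` S)"] v L(2) S(1)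
          spanS by auto
      moreover have "v \<notin> L ` S" using nv complex_vector.span_base[of v "L ` S"] by auto
      moreover have "card (L ` S) = card S"
        by (rule card_image, rule inj_on_subset[OF inj S(1)])
      ultimately show False using finS by simp
    qed
  qed
  also have "\<dots> = L ` V" by (simp add: L.span_image spanS)
  finally show ?thesis by (rule subset_antisym[OF L(2)])
qed

lemma star_subalgebraD:
  assumes "star_subalgebra S"
  shows "complex_vector.subspace S" "0 \<in> S" "a \<in> S \<Longrightarrow> b \<in> S \<Longrightarrow> a * b \<in> S"
    "a \<in> S \<Longrightarrow> b \<in> S \<Longrightarrow> a + b \<in> S" "a \<in> S \<Longrightarrow> b \<in> S \<Longrightarrow> a - b \<in> S"
    "a \<in> S \<Longrightarrow> c *\<^sub>C a \<in> S" "a \<in> S \<Longrightarrow> adj a \<in> S"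
  using assms unfolding star_subalgebra_def subalgebra_def
  by (auto simp: complex_vector.subspace_0 complex_vector.subspace_add
      complex_vector.subspace_diff complex_vector.subspace_scale)

text \<open>As \<open>e\<close> commutes with \<open>e\<^sup>*\<close>, the element \<open>f = e - e\<^sup>*e\<close> satisfies \<open>f\<^sup>*f = 0\<close>.\<close>

lemma idempotent_imp_projection:
  assumes D: "abelian_star_subalgebra D" and e: "e \<in> D" "e * e = e"
  shows "projection e"
proof -
  have S: "star_subalgebra D" and comm: "\<And>a b. a \<in> D \<Longrightarrow> b \<in> D \<Longrightarrow> a * b = b * a"
    using D by (auto simp: abelian_star_subalgebra_def)
  have ae: "adj e \<in> D" by (rule star_subalgebraD(7)[OF S e(1)])
  have ee: "adj e * adj e = adj e" using e by (simp flip: adj_mult)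
  have c: "e * adj e = adj e * e" by (rule comm[OF e(1) ae])
  let ?f = "e - adj e * e"
  have "adj ?f * ?f = adj e * e - (adj e * adj e) * e - (adj e * e) * e + (adj e * e) * (adj e * e)"
    by (simp add: adj_diff adj_mult adj_adj algebra_simps mult.assoc)
  also have "(adj e * e) * (adj e * e) = adj e * e"
    by (metis c e(2) ee mult.assoc)
  also have "(adj e * e) * e = adj e * e" by (simp add: mult.assoc e)
  finally have "adj ?f * ?f = 0" by (simp add: ee)
  then have "e = adj e * e" by (simp add: adj_mult_self_eq_0)
  then have "adj e = e" by (metis adj_adj adj_mult)
  then show ?thesis using e by (simp add: projection_def)
qed

text \<open>
  Multiplication by \<open>y\<close> is injective on the ideal generated by \<open>y\<close>, because an abelian
  C*-algebra has no nonzero nilpotents. In finite dimensions it is therefore surjective there, and the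
  ideal has a unit.
\<close>

lemma support_projection:
  fixes D :: "'b::cstar_algebra set"
  assumes D: "abelian_star_subalgebra D" and fd: "D \<subseteq> complex_vector.span F" "finite F"
    and y: "y \<in> D"
  obtains e c u where "e \<in> D" "projection e" "y * e = y" "u \<in> D" "e = c *\<^sub>C y + y * u"
proof -
  have S: "star_subalgebra D" and comm: "\<And>a b. a \<in> D \<Longrightarrow> b \<in> D \<Longrightarrow> a * b = b * a"
    using D by (auto simp: abelian_star_subalgebra_def)
  note SD = star_subalgebraD[OF S]
  let ?V = "{c *\<^sub>C y + y * u | c u. u \<in> D}"
  have VD: "?V \<subseteq> D" using SD y by auto
  have sub: "complex_vector.subspace ?V"
  proof (rule complex_vector.subspaceI)
    show "0 \<in> ?V" using SD(2) by (auto intro!: exI[of _ 0])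
  next
    fix a b assume "a \<in> ?V" "b \<in> ?V"
    then obtain c u c' u' where *: "a = c *\<^sub>C y + y * u" "b = c' *\<^sub>C y + y * u'" "u \<in> D" "u' \<in> D"
      by blast
    have "a + b = (c + c') *\<^sub>C y + y * (u + u')"
      by (simp add: * scaleC_add_left algebra_simps)
    then show "a + b \<in> ?V" using * SD(4) by blast
  next
    fix k a assume "a \<in> ?V"
    then obtain c u where *: "a = c *\<^sub>C y + y * u" "u \<in> D" by blast
    have "k *\<^sub>C a = (k * c) *\<^sub>C y + y * (k *\<^sub>C u)"
      by (simp add: * scaleC_add_right scaleC_scaleC mult_scaleC_right)
    then show "k *\<^sub>C a \<in> ?V" using * SD(6) by blast
  qed
  have inj: "v = 0" if v: "v \<in> ?V" "y * v = 0" for v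
  proof -
    obtain c u where *: "v = c *\<^sub>C y + y * u" "u \<in> D" using v by blast
    have vD: "v \<in> D" using v VD by blast
    have "v * v = c *\<^sub>C (y * v) + u * (y * v)"
      using * comm[OF y *(2)] by (simp add: distrib_right mult_scaleC_left mult.assoc)
    then have vv: "v * v = 0" using v by simp
    have "(adj v * v) * (adj v * v) = adj v * adj v * (v * v)"
      using comm[OF vD SD(7)[OF vD]] by (metis mult.assoc)
    then have "adj (adj v * v) * (adj v * v) = 0" by (simp add: vv adj_mult adj_adj)
    then show "v = 0" by (simp only: adj_mult_self_eq_0)
  qed
  have img: "(\<lambda>x. y * x) ` ?V \<subseteq> ?V"
  proof
    fix z assume "z \<in> (\<lambda>x. y * x) ` ?V"
    then obtain v where "v \<in> D" "z = y * v" using VD by blast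
    then show "z \<in> ?V" by (auto intro!: exI[of _ 0] exI[of _ v])
  qed
  have surj: "(\<lambda>x. y * x) ` ?V = ?V"
    by (rule injective_imp_surjective_on_subspace[OF sub _ fd(2) linear_mult_left img])
      (use VD fd inj in auto)
  have "y = 1 *\<^sub>C y + y * 0" by simp
  then have "y \<in> ?V" using SD(2) by blast
  then have "y \<in> (\<lambda>x. y * x) ` ?V" by (simp only: surj)
  then obtain e where e: "e \<in> ?V" "y = y * e" by (rule imageE)
  then obtain c u where cu: "e = c *\<^sub>C y + y * u" "u \<in> D" by blast
  have eD: "e \<in> D" using e VD by blast
  have ye: "e * y = y" using comm[OF eD y] e by simp
  have "e * e = c *\<^sub>C (e * y) + (e * y) * u"
    by (subst (2) cu(1)) (simp add: distrib_left mult_scaleC_right mult.assoc)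
  then have "e * e = e" by (simp add: ye flip: cu(1))
  then have "projection e" using idempotent_imp_projection[OF D eD] by simp
  then show ?thesis using that eD e cu by metis
qed

text \<open>Here \<open>p\<close> takes the part of the unit: the constant polynomial \<open>c\<close> has the value \<open>c p\<close>.\<close>

definition poly_eval :: "'b::cstar_algebra \<Rightarrow> 'b \<Rightarrow> complex poly \<Rightarrow> 'b" where
  "poly_eval p z m = (\<Sum>i\<le>degree m. coeff m i *\<^sub>C (((*) z) ^^ i) p)"

lemma poly_eval_altdef:
  "degree m \<le> n \<Longrightarrow> poly_eval p z m = (\<Sum>i\<le>n. coeff m i *\<^sub>C (((*) z) ^^ i) p)"
  unfolding poly_eval_def by (intro sum.mono_neutral_left) (auto simp: coeff_eq_0)

lemma poly_eval_add: "poly_eval p z (m + m') = poly_eval p z m + poly_eval p z m'"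
  using poly_eval_altdef[of "m + m'" "max (degree m) (degree m')" p z]
    poly_eval_altdef[of m "max (degree m) (degree m')" p z]
    poly_eval_altdef[of m' "max (degree m) (degree m')" p z]
  by (simp add: degree_add_le sum.distrib scaleC_add_left)

lemma poly_eval_smult: "poly_eval p z (smult c m) = c *\<^sub>C poly_eval p z m"
  using poly_eval_altdef[of "smult c m" "degree m" p z]
  by (simp add: poly_eval_def complex_vector.scale_sum_right)

lemma poly_eval_shift: "poly_eval p z (pCons 0 m) = z * poly_eval p z m"
  using poly_eval_altdef[of "pCons 0 m" "Suc (degree m)" p z]
  by (simp add: poly_eval_def sum.atMost_Suc_shift sum_distrib_left mult_scaleC_right
      degree_pCons_le del: sum.atMost_Suc)

text \<open>
  By the fundamental theorem of algebra a nonzero polynomial in \<open>z\<close> is, up to a nonzero scalar, a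
  product of factors \<open>z - c p\<close>, and all of these act injectively. In finite dimensions the powers of \<open>z\<close> are linearly dependent, so that
  some factor must fail to be injective: this is how eigenvalues are found.
\<close>

lemma poly_eval_eq_0_imp_eq_0:
  assumes p: "p \<noteq> 0" "p * p = p" "z * p = z" "p * z = z"
    and inj: "\<And>c v. p * v = v \<Longrightarrow> (z - c *\<^sub>C p) * v = 0 \<Longrightarrow> v = 0"
  shows "poly_eval p z m = 0 \<Longrightarrow> m = 0"
proof (induction "degree m" arbitrary: m rule: less_induct)
  case less
  show ?case
  proof (cases "degree m = 0")
    case True
    then obtain a where "m = [:a:]" by (auto elim: degree_eq_zeroE)
    then show ?thesis using less p by (simp add: poly_eval_def)
  next
    case False
    then have "\<not> constant (poly m)" by (simp add: constant_degree)
    then obtain c where "poly m c = 0" using fundamental_theorem_of_algebra by blast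
    then obtain q where q: "m = [:- c, 1:] * q" by (auto simp: poly_eq_0_iff_dvd dvd_def)
    have pow: "p * (((*) z) ^^ i) p = (((*) z) ^^ i) p" for i
      using p by (cases i) (auto simp flip: mult.assoc)
    have pq: "p * poly_eval p z q = poly_eval p z q"
      by (simp add: poly_eval_def sum_distrib_left mult_scaleC_right pow)
    have m: "m = smult (- c) q + pCons 0 q" by (simp add: q)
    have "poly_eval p z m = (z - c *\<^sub>C p) * poly_eval p z q"
      unfolding m poly_eval_add poly_eval_smult poly_eval_shift
      by (simp add: left_diff_distrib mult_scaleC_left pq)
    then have "poly_eval p z q = 0" using inj pq less.prems by simp
    moreover have "q = 0 \<or> degree q < degree m"
      by (cases "q = 0") (simp_all add: q degree_mult_eq del: mult_pCons_left)
    ultimately show ?thesis using less.hyps[of q] q by (metis mult_zero_right)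
  qed
qed

lemma sequence_linearly_dependent:
  fixes v :: "nat \<Rightarrow> 'b::complex_vector"
  assumes fin: "finite F" and v: "\<And>i. v i \<in> complex_vector.span F"
  shows "\<exists>c n. (\<exists>i\<le>n. c i \<noteq> 0) \<and> (\<Sum>i\<le>n. c i *\<^sub>C v i) = 0"
proof -
  let ?n = "card F"
  show ?thesis
  proof (cases "inj_on v {..?n}")
    case True
    then have card: "card (v ` {..?n}) = Suc ?n" by (simp add: card_image)
    have "v ` {..?n} \<subseteq> complex_vector.span F" using v by auto
    then have "complex_vector.dependent (v ` {..?n})"
      using complex_vector.independent_span_bound[OF fin, of "v ` {..?n}"] card by linarith
    then obtain u where u: "\<exists>w\<in>v ` {..?n}. u w \<noteq> 0" "(\<Sum>w\<in>v ` {..?n}. u w *\<^sub>C w) = 0"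
      by (subst (asm) complex_vector.dependent_finite) auto
    show ?thesis
      using u by (intro exI[of _ "u \<circ> v"] exI[of _ ?n]) (auto simp: sum.reindex[OF True])
  next
    case False
    then obtain i j where ij: "i \<le> ?n" "j \<le> ?n" "i \<noteq> j" "v i = v j" by (auto simp: inj_on_def)
    let ?c = "\<lambda>k. if k = i then 1 else if k = j then - 1 else (0::complex)"
    have "(\<Sum>k\<le>?n. ?c k *\<^sub>C v k) = (\<Sum>k\<in>{i, j}. ?c k *\<^sub>C v k)"
      using ij by (intro sum.mono_neutral_right) auto
    also have "\<dots> = 0" using ij by (simp add: complex_vector.scale_minus_left)
    finally show ?thesis using ij by (intro exI[of _ ?c] exI[of _ ?n]) auto
  qed
qed

lemma orthogonal_projections_independent:
  assumes F: "orthogonal_projections F" "0 \<notin> F"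
  shows "complex_vector.independent F"
proof
  have "finite F" using F by (simp add: orthogonal_projections_def)
  moreover assume "complex_vector.dependent F"
  ultimately obtain u q where u: "q \<in> F" "u q \<noteq> 0" "(\<Sum>w\<in>F. u w *\<^sub>C w) = 0"
    by (auto simp: complex_vector.dependent_finite)
  then have "u q *\<^sub>C q = 0" using sum_mult_orthogonal(1)[OF F(1) u(1), of u] by simp
  then show False using u F by auto
qed

lemma orthogonal_projections_insert:
  assumes "orthogonal_projections F" "projection e" "\<And>p. p \<in> F \<Longrightarrow> e * p = 0"
  shows "orthogonal_projections (insert e F)"
proof -
  have "p * e = 0" if "p \<in> F" for p
  proof -
    have "adj (e * p) = p * e"
      using assms(1,2) that by (simp add: adj_mult orthogonal_projections_def projection_def)
    then show ?thesis using assms(3)[OF that] by simp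
  qed
  then show ?thesis using assms by (auto simp: orthogonal_projections_def)
qed

text \<open>
  A family of nonzero orthogonal projections with as many members as possible cannot be refined or
  enlarged. The support projection of \<open>d - d (\<Sum>P)\<close> would enlarge it; the support projections of
  \<open>d p - c p\<close> lie below \<open>p\<close>, so that each equals \<open>p\<close> or \<open>0\<close>, and \<open>0\<close> occurs for an eigenvalue \<open>c\<close>.
\<close>

proposition abelian_star_subalgebra_diagonalize:
  fixes D :: "'b::cstar_algebra set"
  assumes D: "abelian_star_subalgebra D" and fd: "finite_dimensional D"
  obtains P where "P \<subseteq> D" "orthogonal_projections P" "0 \<notin> P"
    "\<And>d p. d \<in> D \<Longrightarrow> p \<in> P \<Longrightarrow> \<exists>c. d * p = c *\<^sub>C p" "\<And>d. d \<in> D \<Longrightarrow> d * \<Sum>P = d"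
proof -
  have S: "star_subalgebra D" and comm: "\<And>a b. a \<in> D \<Longrightarrow> b \<in> D \<Longrightarrow> a * b = b * a"
    using D by (auto simp: abelian_star_subalgebra_def)
  note SD = star_subalgebraD[OF S]
  obtain F where F: "finite F" "D = complex_vector.span F"
    using fd by (auto simp: finite_dimensional_def)
  then have DF: "D \<subseteq> complex_vector.span F" by simp
  let ?ok = "\<lambda>P. P \<subseteq> D \<and> orthogonal_projections P \<and> 0 \<notin> P"
  have bound: "card P \<le> card F" if "?ok P" for P
    using complex_vector.independent_span_bound[OF F(1) orthogonal_projections_independent, of P]
      that DF by blast
  have "?ok {}" by (simp add: orthogonal_projections_def)
  then obtain P where P: "?ok P" and max: "\<And>Q. ?ok Q \<Longrightarrow> card Q \<le> card P"
    using bound ex_has_greatest_nat[of ?ok "{}" card "Suc (card F)"] by (auto simp: le_imp_less_Suc)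
  have finP: "finite P" using P by (simp add: orthogonal_projections_def)
  have pp: "p * p = p" "adj p = p" "p \<noteq> 0" "p \<in> D" if "p \<in> P" for p
    using P that by (auto simp: orthogonal_projections_def projection_def)
  have sumP: "\<Sum>P \<in> D" using P SD(1) by (auto intro!: complex_vector.subspace_sum)
  show ?thesis
  proof (rule that[of P])
    show "d * \<Sum>P = d" if d: "d \<in> D" for d
    proof (rule ccontr)
      assume neq: "d * \<Sum>P \<noteq> d"
      let ?y = "d - d * \<Sum>P"
      have yD: "?y \<in> D" by (intro SD d sumP)
      obtain e c u where e: "e \<in> D" "projection e" "?y * e = ?y" "u \<in> D" "e = c *\<^sub>C ?y + ?y * u"
        using support_projection[OF D DF F(1) yD] by blast
      have yp: "?y * p = 0" if "p \<in> P" for p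
        using sum_orthogonal_mult(1)[of P p] P that by (simp add: left_diff_distrib mult.assoc)
      have ep: "e * p = 0" if p: "p \<in> P" for p
      proof -
        have "p * ?y = 0" using yp[OF p] comm[OF yD pp(4)[OF p]] by simp
        then have "p * e = 0"
          by (subst e(5)) (simp add: distrib_left mult_scaleC_right flip: mult.assoc)
        then show ?thesis using comm[OF e(1) pp(4)[OF p]] by simp
      qed
      have e0: "e \<noteq> 0" using e(3) neq by auto
      have "e \<notin> P" using ep pp e0 e(2) by (metis projection_def)
      moreover have "?ok (insert e P)"
        using P e e0 ep by (auto intro: orthogonal_projections_insert)
      then have "card (insert e P) \<le> card P" by (rule max)
      ultimately show False using finP by simp
    qed
  next
    fix d p assume d: "d \<in> D" and p: "p \<in> P"
    have whole: "e = p" if e: "e \<in> D" "projection e" "e * p = e" "e \<noteq> 0" for e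
    proof (rule ccontr)
      assume "e \<noteq> p"
      let ?f = "p - e"
      let ?Q = "P - {p}"
      have pe: "p * e = e" using comm[OF e(1) pp(4)[OF p]] e by simp
      have pf: "projection ?f"
        using e pe pp[OF p] by (simp add: projection_def adj_diff algebra_simps)
      have pq: "p * q = 0" if "q \<in> ?Q" for q
        using P p that by (auto simp: orthogonal_projections_def)
      have eq: "e * q = 0" if "q \<in> ?Q" for q
        using pq[OF that] e(3) by (metis mult.assoc mult_zero_right)
      have fq: "?f * q = 0" if "q \<in> ?Q" for q
        using pq[OF that] eq[OF that] by (simp add: left_diff_distrib)
      have Q: "orthogonal_projections ?Q" using P orthogonal_projections_subset by blast
      have 1: "orthogonal_projections (insert e ?Q)"
        by (rule orthogonal_projections_insert[OF Q e(2) eq])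
      have fe: "?f * e = 0" using pe e(2) by (simp add: left_diff_distrib projection_def)
      have "orthogonal_projections (insert ?f (insert e ?Q))"
        by (rule orthogonal_projections_insert[OF 1 pf]) (use fe fq in auto)
      then have "?ok (insert ?f (insert e ?Q))"
        using P e(1,4) \<open>e \<noteq> p\<close> SD(5)[OF pp(4)[OF p] e(1)] by auto
      then have le: "card (insert ?f (insert e ?Q)) \<le> card P" by (rule max)
      have "e \<notin> ?Q" using eq e by (metis projection_def)
      moreover have "?f \<notin> insert e ?Q"
        using fe fq pf \<open>e \<noteq> p\<close> by (metis eq_iff_diff_eq_0 insert_iff projection_def)
      ultimately have "card (insert ?f (insert e ?Q)) = Suc (Suc (card ?Q))"
        using finP by simp
      moreover have "Suc (card ?Q) = card P" using finP p by (rule card_Suc_Diff1)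
      ultimately show False using le by simp
    qed
    let ?z = "d * p"
    show "\<exists>c. d * p = c *\<^sub>C p"
    proof (rule ccontr)
      assume no: "\<nexists>c. d * p = c *\<^sub>C p"
      have zD: "?z \<in> D" by (intro SD d pp p)
      have zp: "?z * p = ?z" "p * ?z = ?z"
        using pp[OF p] comm[OF pp(4)[OF p] zD] by (simp_all add: mult.assoc)
      have "poly_eval p ?z m = 0 \<Longrightarrow> m = 0" for m
      proof (rule poly_eval_eq_0_imp_eq_0[OF pp(3)[OF p] pp(1)[OF p] zp])
        fix c v assume v: "p * v = v" "(?z - c *\<^sub>C p) * v = 0"
        let ?y = "?z - c *\<^sub>C p"
        have yD: "?y \<in> D" by (intro SD(5,6) zD pp p)
        have y0: "?y \<noteq> 0" using no by auto
        obtain e k u where e: "e \<in> D" "projection e" "?y * e = ?y" "u \<in> D" "e = k *\<^sub>C ?y + ?y * u"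
          using support_projection[OF D DF F(1) yD] by blast
        have py: "p * ?y = ?y" using zp pp[OF p] by (simp add: right_diff_distrib mult_scaleC_right)
        have "p * e = e"
          by (subst (1 2) e(5)) (simp add: distrib_left mult_scaleC_right py flip: mult.assoc)
        then have "e * p = e" using comm[OF e(1) pp(4)[OF p]] by simp
        moreover have "e \<noteq> 0" using e(3) y0 by auto
        ultimately have "e = p" using whole e by blast
        moreover have "e = k *\<^sub>C ?y + u * ?y" using e(5) comm[OF yD e(4)] by simp
        ultimately have "p * v = k *\<^sub>C (?y * v) + u * (?y * v)"
          by (metis distrib_right mult.assoc mult_scaleC_left)
        then show "v = 0" using v by simp
      qed
      moreover have "(((*) ?z) ^^ i) p \<in> D" for i
        by (induction i) (use pp p SD zD in auto)
      then obtain c n where c: "\<exists>i\<le>n. c i \<noteq> 0" "(\<Sum>i\<le>n. c i *\<^sub>C (((*) ?z) ^^ i) p) = 0"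
        using sequence_linearly_dependent[OF F(1), of "\<lambda>i. (((*) ?z) ^^ i) p"] F(2) by blast
      define m where "m = (\<Sum>i\<le>n. monom (c i) i)"
      have coeff: "coeff m i = (if i \<le> n then c i else 0)" for i
        by (simp add: m_def coeff_sum)
      have "degree m \<le> n" by (rule degree_le) (simp add: coeff)
      then have "poly_eval p ?z m = 0" using c(2) by (simp add: poly_eval_altdef coeff)
      moreover have "m \<noteq> 0" using c(1) coeff by (metis coeff_0)
      ultimately show False by blast
    qed
  qed (use P in auto)
qed

section \<open>Matrix units for a finite dimensional algebra with a masa\<close>

text \<open>
  The double commutant within \<open>B\<close> of \<open>D\<close> and \<open>x\<close> is an abelian star subalgebra containing both, so it
  is \<open>D\<close> by maximality.
\<close>

lemma masa_contains_commuting_selfadjoint: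
  fixes B D :: "'b::cstar_algebra set"
  assumes B: "star_subalgebra B" and D: "masa B D"
    and x: "x \<in> B" "adj x = x" and comm: "\<And>d. d \<in> D \<Longrightarrow> d * x = x * d"
  shows "x \<in> D"
proof -
  note SB = star_subalgebraD[OF B]
  have SD: "star_subalgebra D" and DD: "\<And>a b. a \<in> D \<Longrightarrow> b \<in> D \<Longrightarrow> a * b = b * a" and DB: "D \<subseteq> B"
    using D by (auto simp: masa_def abelian_star_subalgebra_def)
  define S where "S = insert x D"
  define C where "C = {y. \<forall>s\<in>S. y * s = s * y}"
  define E where "E = {y\<in>B. \<forall>z\<in>C. y * z = z * y}"
  have S_adj: "adj s \<in> S" if "s \<in> S" for s
    using that x star_subalgebraD(7)[OF SD] by (auto simp: S_def)
  have S_C: "S \<subseteq> C" using DD comm by (auto simp: S_def C_def)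
  have C_adj: "adj z \<in> C" if "z \<in> C" for z
  proof -
    have "adj z * s = s * adj z" if s: "s \<in> S" for s
    proof -
      have "adj (adj s * z) = adj (z * adj s)" using S_adj[OF s] \<open>z \<in> C\<close> by (simp add: C_def)
      then show ?thesis by (simp add: adj_mult adj_adj)
    qed
    then show ?thesis by (simp add: C_def)
  qed
  have E_adj: "adj y \<in> E" if "y \<in> E" for y
  proof -
    have "adj y * z = z * adj y" if z: "z \<in> C" for z
    proof -
      have "adj (adj z * y) = adj (y * adj z)" using C_adj[OF z] \<open>y \<in> E\<close> by (simp add: E_def)
      then show ?thesis by (simp add: adj_mult adj_adj)
    qed
    then show ?thesis using that SB(7) by (simp add: E_def)
  qed
  have E_sub: "complex_vector.subspace E"
    by (rule complex_vector.subspaceI)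
      (use SB in \<open>auto simp: E_def algebra_simps mult_scaleC_left mult_scaleC_right\<close>)
  have E_mult: "a * b \<in> E" if "a \<in> E" "b \<in> E" for a b
    using that SB(3) by (simp add: E_def) (metis mult.assoc)
  have E_C: "E \<subseteq> C" using S_C by (auto simp: E_def C_def)
  have "abelian_star_subalgebra E"
    unfolding abelian_star_subalgebra_def star_subalgebra_def subalgebra_def
    using E_adj E_sub E_mult E_C by (auto simp: E_def)
  moreover have S_E: "S \<subseteq> E" using x DB by (auto simp: E_def C_def S_def)
  ultimately have "E = D" using D by (auto simp: masa_def E_def S_def)
  then show ?thesis using S_E by (auto simp: S_def)
qed

lemma finite_dimensional_subspace:
  assumes "finite_dimensional B" "complex_vector.subspace D" "D \<subseteq> B"
  shows "finite_dimensional D"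
proof -
  obtain F where F: "finite F" "B = complex_vector.span F"
    using assms by (auto simp: finite_dimensional_def)
  obtain S where S: "S \<subseteq> D" "complex_vector.independent S" "D \<subseteq> complex_vector.span S"
    using complex_vector.maximal_independent_subset by metis
  have "finite S" using complex_vector.independent_span_bound[OF F(1) S(2)] S(1) F assms by auto
  then show ?thesis
    using S assms(2) complex_vector.span_subspace unfolding finite_dimensional_def by metis
qed

text \<open>
  \<open>P\<close> is the set of minimal projections of \<open>D\<close>. The entries \<open>p x q\<close> over \<open>P\<close> describe \<open>B\<close> as an
  algebra of block diagonal matrices in which \<open>D\<close> is the diagonal.
\<close>

locale diagonal_frame =
  fixes B D P :: "'b::cstar_algebra set"
  assumes star_B: "star_subalgebra B" and abelian_D: "abelian_star_subalgebra D"
    and D_sub_B: "D \<subseteq> B" and P_sub_D: "P \<subseteq> D"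
    and orthogonal: "orthogonal_projections P" and zero_notin: "0 \<notin> P"
    and diagonal_scalar: "d \<in> D \<Longrightarrow> p \<in> P \<Longrightarrow> \<exists>c. d * p = c *\<^sub>C p"
    and corner_scalar: "x \<in> B \<Longrightarrow> p \<in> P \<Longrightarrow> \<exists>c. p * x * p = c *\<^sub>C p"
    and unit_left: "x \<in> B \<Longrightarrow> \<Sum>P * x = x" and unit_right: "x \<in> B \<Longrightarrow> x * \<Sum>P = x"

text \<open>
  The corner \<open>pBp\<close> is scalar since its self-adjoint elements commute with \<open>D\<close>; the unit of
  \<open>D\<close> is one for \<open>B\<close> since \<open>(x - 1x)(x - 1x)\<^sup>*\<close> commutes with \<open>D\<close>, hence lies in \<open>D\<close>.
\<close>

lemma masa_diagonal_frame:
  fixes B D :: "'b::cstar_algebra set"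
  assumes B: "star_subalgebra B" "finite_dimensional B" and D: "masa B D"
  shows "\<exists>P. diagonal_frame B D P"
proof -
  note SB = star_subalgebraD[OF B(1)]
  have abel: "abelian_star_subalgebra D" and DB: "D \<subseteq> B"
    using D by (auto simp: masa_def)
  then have SD': "star_subalgebra D" and comm: "\<And>a b. a \<in> D \<Longrightarrow> b \<in> D \<Longrightarrow> a * b = b * a"
    by (auto simp: abelian_star_subalgebra_def)
  note SD = star_subalgebraD[OF SD']
  have "finite_dimensional D" by (rule finite_dimensional_subspace[OF B(2) SD(1) DB])
  then obtain P where P: "P \<subseteq> D" "orthogonal_projections P" "0 \<notin> P"
    "\<And>d p. d \<in> D \<Longrightarrow> p \<in> P \<Longrightarrow> \<exists>c. d * p = c *\<^sub>C p" "\<And>d. d \<in> D \<Longrightarrow> d * \<Sum>P = d"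
    using abelian_star_subalgebra_diagonalize[OF abel] by metis
  have pp: "p * p = p" "adj p = p" "p \<in> D" "p \<in> B" if "p \<in> P" for p
    using P that DB by (auto simp: orthogonal_projections_def projection_def)
  let ?u = "\<Sum>P"
  have uD: "?u \<in> D" using P SD(1) by (auto intro!: complex_vector.subspace_sum)
  have ud: "?u * d = d" if "d \<in> D" for d using P(5)[OF that] comm[OF that uD] by simp
  have adju: "adj ?u = ?u" using pp by (simp add: adj_sum)
  have left: "?u * x = x" if x: "x \<in> B" for x
  proof -
    let ?y = "x - ?u * x"
    have yB: "?y \<in> B" using x uD DB SB(3,5) by blast
    have dy: "d * ?y = 0" if "d \<in> D" for d
      using P(5)[OF that] by (simp add: right_diff_distrib flip: mult.assoc)
    have yd: "adj ?y * d = 0" if "d \<in> D" for d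
    proof -
      have "adj (adj d * ?y) = 0" using dy SD(7)[OF that] by simp
      then show ?thesis by (simp add: adj_mult adj_adj)
    qed
    have "?y * adj ?y \<in> D"
    proof (rule masa_contains_commuting_selfadjoint[OF B(1) D])
      show "?y * adj ?y \<in> B" by (intro SB yB)
      show "adj (?y * adj ?y) = ?y * adj ?y" by (simp add: adj_mult adj_adj)
      show "d * (?y * adj ?y) = ?y * adj ?y * d" if "d \<in> D" for d
        using dy[OF that] yd[OF that] by (simp add: mult.assoc) (simp flip: mult.assoc)
    qed
    then have "?u * (?y * adj ?y) = ?y * adj ?y" by (rule ud)
    then have "?y * adj ?y = 0" using dy[OF uD] by (simp flip: mult.assoc)
    then show ?thesis by (simp add: mult_adj_self_eq_0)
  qed
  have right: "x * ?u = x" if x: "x \<in> B" for x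
  proof -
    have "adj (?u * adj x) = x" using left[OF SB(7)[OF x]] by (simp add: adj_adj)
    then show ?thesis by (simp add: adj_mult adj_adj adju)
  qed
  have selfadj: "\<exists>c. p * h * p = c *\<^sub>C p" if h: "h \<in> B" "adj h = h" and p: "p \<in> P" for h p
  proof -
    have "p * h * p \<in> D"
    proof (rule masa_contains_commuting_selfadjoint[OF B(1) D])
      show "p * h * p \<in> B" by (intro SB h pp p)
      show "adj (p * h * p) = p * h * p" using pp[OF p] h by (simp add: adj_mult mult.assoc)
      show "d * (p * h * p) = p * h * p * d" if d: "d \<in> D" for d
      proof -
        obtain c where c: "d * p = c *\<^sub>C p" using P(4)[OF d p] by blast
        then have "p * d = c *\<^sub>C p" using comm[OF d pp(3)[OF p]] by simp
        then show ?thesis using c by (simp add: mult.assoc mult_scaleC_right)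
          (simp add: mult_scaleC_left flip: mult.assoc)
      qed
    qed
    then show ?thesis using P(4)[OF _ p, of "p * h * p"] pp[OF p] by (simp add: mult.assoc)
  qed
  have corner: "\<exists>c. p * x * p = c *\<^sub>C p" if x: "x \<in> B" and p: "p \<in> P" for x p
  proof -
    have ax: "adj x \<in> B" by (rule SB(7)[OF x])
    obtain c where c: "p * (x + adj x) * p = c *\<^sub>C p"
      using selfadj[of "x + adj x" p] SB(4)[OF x ax] p by (auto simp: adj_add adj_adj add.commute)
    obtain k where k: "p * (\<i> *\<^sub>C (x - adj x)) * p = k *\<^sub>C p"
      using selfadj[of "\<i> *\<^sub>C (x - adj x)" p] SB(6)[OF SB(5)[OF x ax]] p
      by (auto simp: adj_scaleC adj_diff adj_adj complex_vector.scale_right_diff_distrib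
          complex_vector.scale_minus_left)
    have "2 *\<^sub>R (p * x * p) = p * (x + adj x) * p + (- \<i>) *\<^sub>C (p * (\<i> *\<^sub>C (x - adj x)) * p)"
      by (simp add: mult_scaleC_left mult_scaleC_right scaleC_scaleC algebra_simps scaleR_2)
    also have "\<dots> = (c - \<i> * k) *\<^sub>C p"
      by (simp add: c k scaleC_scaleC complex_vector.scale_left_diff_distrib)
    finally have "(1/2) *\<^sub>R (2 *\<^sub>R (p * x * p)) = (1/2) *\<^sub>R ((c - \<i> * k) *\<^sub>C p)" by simp
    then have "p * x * p = (complex_of_real (1/2) * (c - \<i> * k)) *\<^sub>C p"
      by (simp add: scaleR_scaleC[of "1/2" "(c - \<i> * k) *\<^sub>C p"] scaleC_scaleC)
    then show ?thesis by blast
  qed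
  have "diagonal_frame B D P"
    by unfold_locales (use B abel DB P corner left right in blast)+
  then show ?thesis by blast
qed

context diagonal_frame
begin

lemmas B_closed = star_subalgebraD[OF star_B]

lemma D_star: "star_subalgebra D" and D_commute: "a \<in> D \<Longrightarrow> b \<in> D \<Longrightarrow> a * b = b * a"
  using abelian_D by (auto simp: abelian_star_subalgebra_def)

lemmas D_closed = star_subalgebraD[OF D_star]

lemma finite_P: "finite P"
  using orthogonal by (simp add: orthogonal_projections_def)

lemma P_facts:
  assumes "p \<in> P" shows "p * p = p" "adj p = p" "p \<noteq> 0" "p \<in> D" "p \<in> B" "projection p"
  using assms orthogonal zero_notin P_sub_D D_sub_B
  by (auto simp: orthogonal_projections_def projection_def)

lemma P_orthogonal: "p \<in> P \<Longrightarrow> q \<in> P \<Longrightarrow> p \<noteq> q \<Longrightarrow> p * q = 0"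
  using orthogonal by (simp add: orthogonal_projections_def)

lemma unit_in_D: "\<Sum>P \<in> D"
  using P_sub_D D_closed(1) by (auto intro!: complex_vector.subspace_sum)

lemma expand_left: "x \<in> B \<Longrightarrow> x = (\<Sum>p\<in>P. p * x)"
  using unit_left[of x] by (simp add: sum_distrib_right)

lemma expand_right: "x \<in> B \<Longrightarrow> x = (\<Sum>p\<in>P. x * p)"
  using unit_right[of x] by (simp add: sum_distrib_left)

lemma expand: "x \<in> B \<Longrightarrow> x = (\<Sum>p\<in>P. \<Sum>q\<in>P. p * x * q)"
  by (subst expand_left, assumption, rule sum.cong[OF refl], rule expand_right)
    (auto intro: B_closed P_facts)

lemma nonzero_middle:
  assumes "x \<in> B" "y \<in> B" "x * y \<noteq> 0" obtains r where "r \<in> P" "x * r \<noteq> 0" "r * y \<noteq> 0"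
proof -
  have "x * y = (\<Sum>r\<in>P. x * r) * y" using expand_right[OF assms(1)] by simp
  also have "\<dots> = (\<Sum>r\<in>P. (x * r) * (r * y))"
    unfolding sum_distrib_right
    by (rule sum.cong[OF refl]) (metis mult.assoc P_facts(1))
  finally have "(\<Sum>r\<in>P. (x * r) * (r * y)) \<noteq> 0" using assms(3) by simp
  then obtain r where "r \<in> P" "(x * r) * (r * y) \<noteq> 0"
    by (rule sum.not_neutral_contains_not_neutral)
  then show ?thesis using that by fastforce
qed

text \<open>
  A nonzero entry is a multiple of a partial isometry. Since \<open>u\<^sup>*u\<close> and \<open>uu\<^sup>*\<close> are scalar, the point is
  that the scalar is positive.
\<close>

lemma entry_square:
  assumes u: "u \<in> B" "p * u = u" "u * q = u" "u \<noteq> 0" and pq: "p \<in> P" "q \<in> P"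
  obtains r where "r > 0" "adj u * u = r *\<^sub>R q" "u * adj u = r *\<^sub>R p"
proof -
  have au: "adj u \<in> B" by (rule B_closed(7)[OF u(1)])
  have qau: "q * adj u = adj u" and aup: "adj u * p = adj u"
    using u pq P_facts(2) by (metis adj_mult)+
  obtain c where c: "adj u * u = c *\<^sub>C q"
    using corner_scalar[OF B_closed(3)[OF au u(1)] pq(2)] u qau by (metis mult.assoc)
  obtain c' where c': "u * adj u = c' *\<^sub>C p"
    using corner_scalar[OF B_closed(3)[OF u(1) au] pq(1)] u aup by (metis mult.assoc)
  have c0: "c \<noteq> 0" using c u(4) adj_mult_self_eq_0[of u] by auto
  have "c *\<^sub>C u = u * adj u * u" using c u(3) by (simp add: mult.assoc mult_scaleC_right)
  also have "\<dots> = c' *\<^sub>C u" using c' u(2) by (simp add: mult_scaleC_left)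
  finally have cc': "c = c'" using u(4) by simp
  have "adj (adj u * u) = adj u * u" by (simp add: adj_mult adj_adj)
  then have "cnj c *\<^sub>C q = c *\<^sub>C q" using c P_facts(2)[OF pq(2)] by (simp add: adj_scaleC)
  then have "cnj c = c" using P_facts(3)[OF pq(2)] by simp
  then obtain r where r: "c = complex_of_real r" by (metis Reals_cases Reals_cnj_iff)
  have "r > 0"
  proof (cases "p = q")
    case True
    then obtain k where k: "u = k *\<^sub>C q"
      using corner_scalar[OF u(1) pq(2)] u by auto
    then have "(cnj k * k) *\<^sub>C q = c *\<^sub>C q"
      using c P_facts[OF pq(2)] by (simp add: adj_scaleC mult_scaleC_left mult_scaleC_right scaleC_scaleC mult.commute)
    then have "cnj k * k = c" using P_facts(3)[OF pq(2)] by simp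
    then have "complex_of_real ((cmod k)\<^sup>2) = complex_of_real r"
      using r by (simp add: complex_norm_square mult.commute del: of_real_power)
    then have "r = (cmod k)\<^sup>2" by (simp only: of_real_eq_iff)
    moreover have "k \<noteq> 0" using k u(4) by auto
    ultimately show ?thesis by simp
  next
    case False
    show ?thesis
    proof (rule ccontr)
      assume "\<not> r > 0"
      then have neg: "r < 0" using r c0 by auto
      \<comment> \<open>If \<open>v\<^sup>*v = - q\<close> and \<open>vv\<^sup>* = - p\<close>, then \<open>a = v + v\<^sup>*\<close> satisfies \<open>a\<^sup>2 = - (p + q)\<close>, and
        \<open>w = p + q + \<i> a\<close> satisfies \<open>w\<^sup>*w = 0\<close>.\<close>
      define v where "v = (1 / sqrt (- r)) *\<^sub>R u"
      have av: "adj v = (1 / sqrt (- r)) *\<^sub>R adj u"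
        by (simp add: v_def adj_scaleR)
      have sq: "(1 / sqrt (- r)) * (1 / sqrt (- r)) * r = - 1" using neg by (simp add: field_simps)
      have uu: "adj u * u = r *\<^sub>R q" "u * adj u = r *\<^sub>R p"
        using c c' unfolding cc'[symmetric] r scaleC_of_real by auto
      have "adj v * v = ((1 / sqrt (- r)) * (1 / sqrt (- r)) * r) *\<^sub>R q"
        "v * adj v = ((1 / sqrt (- r)) * (1 / sqrt (- r)) * r) *\<^sub>R p"
        unfolding av unfolding v_def by (simp_all add: uu)
      then have vv: "adj v * v = - q" "v * adj v = - p" unfolding sq by simp_all
      have v: "p * v = v" "v * q = v" "q * adj v = adj v" "adj v * p = adj v"
        using u qau aup unfolding av unfolding v_def by simp_all
      have o: "p * q = 0" "q * p = 0" using P_orthogonal pq False by auto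
      have z: "v * p = 0" "q * v = 0" "p * adj v = 0" "adj v * q = 0" "v * v = 0" "adj v * adj v = 0"
        using v o by (metis mult.assoc mult_zero_left mult_zero_right)+
      let ?a = "v + adj v" let ?e = "p + q"
      have ea: "?e * ?a = ?a" "?a * ?e = ?a" "?e * ?e = ?e"
        using v z o P_facts pq by (simp_all add: algebra_simps)
      have aa: "?a * ?a = - ?e" using vv z by (simp add: algebra_simps)
      have adjs: "adj ?e = ?e" "adj ?a = ?a" using P_facts pq by (simp_all add: adj_add adj_adj)
      let ?w = "?e + \<i> *\<^sub>C ?a"
      have "adj ?w = ?e + (- \<i>) *\<^sub>C ?a" unfolding adj_add[of ?e] adj_scaleC adjs by simp
      moreover have "(x + (- \<i>) *\<^sub>C y) * (x + \<i> *\<^sub>C y) =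
          x * x + \<i> *\<^sub>C (x * y) + (- \<i>) *\<^sub>C (y * x) + y * y" for x y :: 'b
        by (simp add: distrib_left left_diff_distrib mult_scaleC_left mult_scaleC_right
            scaleC_scaleC complex_vector.scale_minus_left complex_vector.scale_right_diff_distrib)
      ultimately have "adj ?w * ?w = ?e * ?e + \<i> *\<^sub>C (?e * ?a) + (- \<i>) *\<^sub>C (?a * ?e) + ?a * ?a"
        by (simp only:)
      also have "\<dots> = 0" unfolding ea aa by (simp add: complex_vector.scale_minus_left)
      finally have "?w = 0" by (simp only: adj_mult_self_eq_0)
      then have "p * ?w * p = 0" by simp
      then have "p = 0"
        using v z o P_facts(1)[OF pq(1)]
        by (simp add: distrib_left distrib_right mult_scaleC_left mult_scaleC_right mult.assoc)
      then show False using P_facts(3)[OF pq(1)] by simp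
    qed
  qed
  then show ?thesis using c c' unfolding cc'[symmetric] r scaleC_of_real by (rule that)
qed

lemma entries_proportional:
  assumes u: "u \<in> B" "p * u = u" "u * q = u" "u \<noteq> 0" and v: "v \<in> B" "p * v = v" "v * q = v"
    and pq: "p \<in> P" "q \<in> P"
  shows "\<exists>c. v = c *\<^sub>C u"
proof -
  obtain r where r: "r > 0" "adj u * u = r *\<^sub>R q" using entry_square[OF u pq] by blast
  have "adj u * p = adj u" using u(2) P_facts(2)[OF pq(1)] by (metis adj_mult)
  then obtain c where c: "v * adj u = c *\<^sub>C p"
    using corner_scalar[OF B_closed(3)[OF v(1) B_closed(7)[OF u(1)]] pq(1)] v(2) by (metis mult.assoc)
  have "r *\<^sub>R v = v * adj u * u" using r v(3) by (simp add: mult.assoc)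
  also have "\<dots> = c *\<^sub>C u" using c u(2) by (simp add: mult_scaleC_left)
  finally have "(1 / r) *\<^sub>R (r *\<^sub>R v) = (1 / r) *\<^sub>R (c *\<^sub>C u)" by simp
  then have "v = complex_of_real (1 / r) *\<^sub>C (c *\<^sub>C u)"
    using r(1) by (simp add: scaleR_scaleC[of _ "c *\<^sub>C u"])
  then show ?thesis by (auto simp: scaleC_scaleC)
qed

lemma entry_product_nonzero:
  assumes "u \<in> B" "p * u = u" "u * q = u" "u \<noteq> 0" "q * v = v" "v \<noteq> 0" "p \<in> P" "q \<in> P"
  shows "u * v \<noteq> 0"
proof
  assume *: "u * v = 0"
  obtain r where r: "r > 0" "adj u * u = r *\<^sub>R q" using entry_square assms by metis
  have "r *\<^sub>R v = adj u * (u * v)" using r assms(5) by (simp flip: mult.assoc)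
  then show False using * r assms(6) by simp
qed

lemma entry_partial_isometry:
  assumes x: "x \<in> B" "p * x * q \<noteq> 0" and pq: "p \<in> P" "q \<in> P"
  obtains w where "w \<in> B" "p * w = w" "w * q = w" "w * adj w = p" "adj w * w = q"
proof -
  let ?u = "p * x * q"
  have u: "?u \<in> B" by (intro B_closed x P_facts pq)
  have pu: "p * ?u = ?u" "?u * q = ?u"
    using P_facts(1) pq by (simp_all add: mult.assoc) (simp flip: mult.assoc)
  note u = u pu
  obtain r where r: "r > 0" "adj ?u * ?u = r *\<^sub>R q" "?u * adj ?u = r *\<^sub>R p"
    using entry_square[OF u x(2) pq] by blast
  let ?w = "complex_of_real (1 / sqrt r) *\<^sub>C ?u"
  have k: "1 / sqrt r * (1 / sqrt r) * r = 1" using r(1) by (simp add: field_simps)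
  show ?thesis
  proof (rule that[of ?w])
    show "?w \<in> B" by (rule B_closed(6)[OF u(1)])
    show "p * ?w = ?w" "?w * q = ?w"
      using u by (simp_all only: mult_scaleC_left mult_scaleC_right)
    have "?w * adj ?w = (1 / sqrt r * (1 / sqrt r) * r) *\<^sub>R p"
      "adj ?w * ?w = (1 / sqrt r * (1 / sqrt r) * r) *\<^sub>R q"
      unfolding scaleC_of_real adj_scaleR mult_scaleR_left mult_scaleR_right r(2,3) scaleR_scaleR
      by (simp_all only: mult.assoc)
    then show "?w * adj ?w = p" "adj ?w * ?w = q" unfolding k by simp_all
  qed
qed

lemma partial_isometry_normalizes:
  assumes w: "w \<in> B" "p * w = w" "w * q = w" "w * adj w = p" "adj w * w = q" and pq: "p \<in> P" "q \<in> P"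
  shows "w \<in> normalizer B D"
proof -
  have aw: "q * adj w = adj w" "adj w * p = adj w"
    using w pq P_facts(2) by (metis adj_mult)+
  have "w * d * adj w \<in> D" if d: "d \<in> D" for d
  proof -
    obtain c where c: "d * q = c *\<^sub>C q" using diagonal_scalar[OF d pq(2)] by blast
    have "w * d * adj w = w * (d * q) * adj w" using aw by (simp add: mult.assoc)
    also have "\<dots> = c *\<^sub>C p" using w by (simp add: c mult_scaleC_left mult_scaleC_right)
    finally show ?thesis using D_closed(6) P_facts(4) pq by simp
  qed
  moreover have "adj w * d * w \<in> D" if d: "d \<in> D" for d
  proof -
    obtain c where c: "d * p = c *\<^sub>C p" using diagonal_scalar[OF d pq(1)] by blast
    have "adj w * d * w = adj w * (d * p) * w" using w by (simp add: mult.assoc)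
    also have "\<dots> = c *\<^sub>C q" using w aw by (simp add: c mult_scaleC_left mult_scaleC_right)
    finally show ?thesis using D_closed(6) P_facts(4) pq by simp
  qed
  moreover have "partial_isometry w" using w by (simp add: partial_isometry_def)
  ultimately show ?thesis using w(1) by (simp add: normalizer_def)
qed

end

context diagonal_frame
begin

text \<open>
  \<open>b p\<close> is a chosen minimal projection in the summand of \<open>p\<close>, and \<open>w p\<close> leads from \<open>b p\<close> to \<open>p\<close>. For \<open>p\<close>
  and \<open>q\<close> in the same summand, \<open>w p (w q)\<^sup>*\<close> is the matrix unit from \<open>q\<close> to \<open>p\<close>; for different summands
  it is \<open>0\<close>.
\<close>

lemma matrix_units:
  obtains w b where
    "\<And>p. p \<in> P \<Longrightarrow> b p \<in> P \<and> w p \<in> B \<and> p * w p = w p \<and> w p * b p = w p \<and>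
       w p * adj (w p) = p \<and> adj (w p) * w p = b p"
    "\<And>x p q. x \<in> B \<Longrightarrow> p \<in> P \<Longrightarrow> q \<in> P \<Longrightarrow> \<exists>c. p * x * q = c *\<^sub>C (w p * adj (w q))"
proof -
  define rel where "rel p q \<longleftrightarrow> (\<exists>w\<in>B. p * w = w \<and> w * q = w \<and> w * adj w = p \<and> adj w * w = q)" for p q
  define b where "b p = (SOME q. q \<in> P \<and> rel p q)" for p
  have refl: "rel p p" if "p \<in> P" for p
    using P_facts[OF that] by (auto simp: rel_def)
  have sym: "rel q p" if R: "rel p q" and pq: "p \<in> P" "q \<in> P" for p q
  proof -
    obtain w where w: "w \<in> B" "p * w = w" "w * q = w" "w * adj w = p" "adj w * w = q"
      using R unfolding rel_def by blast
    have "q * adj w = adj w" "adj w * p = adj w"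
      using w pq P_facts(2) by (metis adj_mult)+
    then show ?thesis using w B_closed(7) unfolding rel_def by (intro bexI[of _ "adj w"]) (auto simp: adj_adj)
  qed
  have trans: "rel p r" if R: "rel p q" "rel q r" for p q r
  proof -
    obtain w where w: "w \<in> B" "p * w = w" "w * q = w" "w * adj w = p" "adj w * w = q"
      using R unfolding rel_def by blast
    obtain v where v: "v \<in> B" "q * v = v" "v * r = v" "v * adj v = q" "adj v * v = r"
      using R unfolding rel_def by blast
    have 1: "p * (w * v) = w * v" "w * v * r = w * v"
      using w v by (simp add: mult.assoc[symmetric], simp add: mult.assoc)
    have "w * v * adj (w * v) = w * (v * adj v) * adj w" by (simp add: adj_mult mult.assoc)
    then have 2: "w * v * adj (w * v) = p" using v w by simp
    have "adj (w * v) * (w * v) = adj v * (adj w * w) * v" by (simp add: adj_mult mult.assoc)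
    also have "\<dots> = adj v * (q * v)" using w by (simp add: mult.assoc)
    finally have "adj (w * v) * (w * v) = r" using v by simp
    then show ?thesis using 1 2 w v B_closed(3) unfolding rel_def by blast
  qed
  have b: "b p \<in> P \<and> rel p (b p)" if "p \<in> P" for p
    unfolding b_def by (rule someI[of _ p]) (use refl that in auto)
  have b_eq: "b p = b q" if "rel p q" "p \<in> P" "q \<in> P" for p q
    unfolding b_def using trans sym that by metis
  have "\<exists>w. \<forall>p. p \<in> P \<longrightarrow>
      (w p \<in> B \<and> p * w p = w p \<and> w p * b p = w p \<and> w p * adj (w p) = p \<and> adj (w p) * w p = b p)"
    by (intro choice) (use b in \<open>auto simp: rel_def\<close>)
  then obtain w where w: "\<And>p. p \<in> P \<Longrightarrow>
      w p \<in> B \<and> p * w p = w p \<and> w p * b p = w p \<and> w p * adj (w p) = p \<and> adj (w p) * w p = b p"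
    by blast
  show ?thesis
  proof (rule that[of b w])
    fix x p q assume x: "x \<in> B" and pq: "p \<in> P" "q \<in> P"
    show "\<exists>c. p * x * q = c *\<^sub>C (w p * adj (w q))"
    proof (cases "p * x * q = 0")
      case True
      then show ?thesis by (intro exI[of _ 0]) simp
    next
      case False
      have "rel p q" using entry_partial_isometry[OF x False pq] unfolding rel_def by metis
      then have bb: "b p = b q" using b_eq pq by blast
      let ?u = "w p * adj (w q)"
      have u: "?u \<in> B" "p * ?u = ?u" using w pq by (auto intro: B_closed simp flip: mult.assoc)
      have "adj (w q) * q = adj (w q)" using w[OF pq(2)] P_facts(2)[OF pq(2)] by (metis adj_mult)
      then have uq: "?u * q = ?u" by (simp add: mult.assoc)
      have "adj (w p) * ?u * w q = (adj (w p) * w p) * (adj (w q) * w q)" by (simp add: mult.assoc)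
      also have "\<dots> = b q" using w pq bb b P_facts(1) by simp
      finally have "?u \<noteq> 0" using b pq P_facts(3) by force
      moreover have "p * x * q \<in> B" by (intro B_closed x P_facts pq)
      moreover have "p * (p * x * q) = p * x * q" "p * x * q * q = p * x * q"
        using P_facts(1) pq by (simp_all add: mult.assoc) (simp flip: mult.assoc)
      ultimately show ?thesis using entries_proportional[OF u uq] pq by blast
    qed
  qed (use w b in blast)
qed

text \<open>
  A maximal triangular algebra orders the minimal projections of each summand totally: if neither
  \<open>y\<close> nor \<open>y\<^sup>*\<close> belonged to \<open>T\<close>, adding \<open>y\<close> to \<open>T\<close> would produce a larger triangular algebra.
  The algebras are described by the relation between those \<open>p\<close> and \<open>q\<close> with \<open>pTq \<noteq> 0\<close>.
\<close>

proposition maximal_triangular_comparable: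
  assumes T: "maximal_triangular B D T" and qs: "q \<in> P" "s \<in> P"
    and y: "y \<in> B" "q * y = y" "y * s = y"
  shows "y \<in> T \<or> adj y \<in> T"
proof (rule ccontr)
  assume no: "\<not> (y \<in> T \<or> adj y \<in> T)"
  have TB: "T \<subseteq> B" and T_alg: "subalgebra T" and T_D: "T \<inter> adj ` T = D"
    and T_max: "\<And>S. S \<subseteq> B \<Longrightarrow> subalgebra S \<Longrightarrow> S \<inter> adj ` S = D \<Longrightarrow> T \<subseteq> S \<Longrightarrow> S = T"
    using T by (auto simp: maximal_triangular_def triangular_def)
  have T_sub: "complex_vector.subspace T" and T_mult: "\<And>a b. a \<in> T \<Longrightarrow> b \<in> T \<Longrightarrow> a * b \<in> T"
    using T_alg by (auto simp: subalgebra_def)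
  have DT: "D \<subseteq> T" using T_D by blast
  have PT: "p \<in> T" if "p \<in> P" for p using DT P_facts(4)[OF that] by blast
  define R where "R p r \<longleftrightarrow> (\<exists>x\<in>T. p * x * r \<noteq> 0)" for p r
  have R_T: "z \<in> T" if R: "R p r" and P: "p \<in> P" "r \<in> P" and z: "z \<in> B" "p * z = z" "z * r = z" for p r z
  proof -
    obtain x where x: "x \<in> T" "p * x * r \<noteq> 0" using R by (auto simp: R_def)
    have xT: "p * x * r \<in> T" by (intro T_mult PT P x)
    moreover have "p * (p * x * r) = p * x * r" "p * x * r * r = p * x * r"
      using P_facts(1) P by (simp_all add: mult.assoc) (simp flip: mult.assoc)
    ultimately obtain c where "z = c *\<^sub>C (p * x * r)"
      using entries_proportional[of "p * x * r" p r z] x P z TB by blast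
    then show ?thesis using xT T_sub by (simp add: complex_vector.subspace_scale)
  qed
  have R_refl: "R p p" if "p \<in> P" for p
    using PT[OF that] P_facts(1,3)[OF that] by (auto simp: R_def intro!: bexI[of _ p])
  have R_trans: "R p s" if R: "R p r" "R r s" and P: "p \<in> P" "r \<in> P" "s \<in> P" for p r s
  proof -
    obtain x where x: "x \<in> T" "p * x * r \<noteq> 0" using R by (auto simp: R_def)
    obtain z where z: "z \<in> T" "r * z * s \<noteq> 0" using R by (auto simp: R_def)
    have "p * x * r \<in> B" using T_mult PT P x TB by blast
    moreover have "p * (p * x * r) = p * x * r" "p * x * r * r = p * x * r" "r * (r * z * s) = r * z * s"
      using P_facts(1) P by (simp_all add: mult.assoc) (simp_all flip: mult.assoc)
    ultimately have "(p * x * r) * (r * z * s) \<noteq> 0"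
      using x(2) z(2) P(1,2) entry_product_nonzero[of "p * x * r" p r "r * z * s"] by blast
    moreover have "(p * x * r) * (r * z * s) = p * (x * r * z) * s"
      using P_facts(1)[OF P(2)] by (metis mult.assoc)
    ultimately show ?thesis using T_mult PT P x z unfolding R_def by metis
  qed
  have R_antisym: "p = r" if R: "R p r" "R r p" and P: "p \<in> P" "r \<in> P" for p r
  proof (rule ccontr)
    assume "p \<noteq> r"
    obtain x where x: "x \<in> T" "p * x * r \<noteq> 0" using R by (auto simp: R_def)
    let ?u = "p * x * r"
    have uT: "?u \<in> T" by (intro T_mult PT P x)
    then have auB: "adj ?u \<in> B" using TB B_closed(7) by blast
    have u: "p * ?u = ?u" "?u * r = ?u"
      using P_facts(1) P by (simp_all add: mult.assoc) (simp flip: mult.assoc)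
    then have "r * adj ?u = adj ?u" "adj ?u * p = adj ?u"
      using P_facts(2) P by (metis adj_mult)+
    then have "adj ?u \<in> T" using R_T[OF R(2) P(2,1) auB] by blast
    then have "?u \<in> D" using T_D uT by (metis IntI adj_adj imageI)
    then have "?u = p * r * ?u" using D_commute P_facts(4) P u by (metis mult.assoc)
    then show False using x(2) P_orthogonal[OF P \<open>p \<noteq> r\<close>] by simp
  qed
  have nR: "\<not> R q s" "\<not> R s q"
  proof -
    show "\<not> R q s" using R_T[OF _ qs y] no by blast
    have "s * adj y = adj y" "adj y * q = adj y"
      using P_facts(2) qs y by (metis adj_mult)+
    then show "\<not> R s q" using R_T[OF _ qs(2,1) B_closed(7)[OF y(1)]] no by blast
  qed
  \<comment> \<open>\<open>R'\<close> is the transitive closure of \<open>R\<close> together with the pair \<open>(q, s)\<close> of \<open>y\<close>; it is antisymmetric as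
    \<open>(s, q)\<close> is not in \<open>R\<close>.\<close>
  define R' where "R' p r \<longleftrightarrow> R p r \<or> (R p q \<and> R s r)" for p r
  have R'_trans: "R' p t" if "R' p r" "R' r t" "p \<in> P" "r \<in> P" "t \<in> P" for p r t
    using that nR R_trans qs unfolding R'_def by metis
  have R'_antisym: "p = r" if "R' p r" "R' r p" "p \<in> P" "r \<in> P" for p r
    using that nR R_trans R_antisym qs unfolding R'_def by metis
  define T' where "T' = {x\<in>B. \<forall>p\<in>P. \<forall>r\<in>P. p * x * r \<noteq> 0 \<longrightarrow> R' p r}"
  have T_T': "T \<subseteq> T'" using TB by (auto simp: T'_def R'_def R_def)
  have T'_sub: "complex_vector.subspace T'"
  proof (rule complex_vector.subspaceI)
    show "0 \<in> T'" using B_closed(2) by (simp add: T'_def)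
  next
    fix a b assume "a \<in> T'" "b \<in> T'"
    moreover have "p * (a + b) * r \<noteq> 0 \<Longrightarrow> p * a * r \<noteq> 0 \<or> p * b * r \<noteq> 0" for p r
      by (auto simp: algebra_simps)
    ultimately show "a + b \<in> T'" using B_closed(4) unfolding T'_def by blast
  next
    fix c a assume "a \<in> T'"
    then show "c *\<^sub>C a \<in> T'"
      using B_closed(6) by (auto simp: T'_def mult_scaleC_left mult_scaleC_right)
  qed
  have T'_mult: "a * b \<in> T'" if ab: "a \<in> T'" "b \<in> T'" for a b
  proof -
    have aB: "a \<in> B" and bB: "b \<in> B" using ab by (auto simp: T'_def)
    have "R' p r" if p: "p \<in> P" and r: "r \<in> P" and ne: "p * (a * b) * r \<noteq> 0" for p r
    proof -
      have "(p * a) * (b * r) \<noteq> 0" using ne by (simp add: mult.assoc)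
      then obtain t where t: "t \<in> P" "p * a * t \<noteq> 0" "t * (b * r) \<noteq> 0"
        using nonzero_middle[of "p * a" "b * r"] B_closed(3) P_facts(5) p r aB bB by metis
      then show ?thesis
        using ab p r by (intro R'_trans[of p t r]) (auto simp: T'_def mult.assoc)
    qed
    then show ?thesis using aB bB B_closed(3) by (simp add: T'_def)
  qed
  have T'_D: "T' \<inter> adj ` T' = D"
  proof
    show "D \<subseteq> T' \<inter> adj ` T'"
    proof
      fix d assume d: "d \<in> D"
      then have "d \<in> T'" "adj d \<in> T'" using D_closed(7) DT T_T' by blast+
      then show "d \<in> T' \<inter> adj ` T'" by (metis IntI adj_adj imageI)
    qed
    show "T' \<inter> adj ` T' \<subseteq> D"
    proof
      fix x assume "x \<in> T' \<inter> adj ` T'"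
      then have x: "x \<in> T'" "adj x \<in> T'" by (auto simp: adj_adj)
      then have xB: "x \<in> B" by (simp add: T'_def)
      have off: "p * x * r = 0" if p: "p \<in> P" and r: "r \<in> P" and "p \<noteq> r" for p r
      proof (rule ccontr)
        assume ne: "p * x * r \<noteq> 0"
        have "r * adj x * p = adj (p * x * r)"
          using P_facts(2) p r by (simp add: adj_mult mult.assoc)
        then have "r * adj x * p \<noteq> 0" using ne by (metis adj_adj adj_zero)
        then show False using R'_antisym[of p r] x p r ne \<open>p \<noteq> r\<close> by (auto simp: T'_def)
      qed
      have "(\<Sum>r\<in>P. p * x * r) = p * x * p" if "p \<in> P" for p
        using finite_P that off by (subst sum.remove[of _ p]) (auto intro!: sum.neutral)
      then have "x = (\<Sum>p\<in>P. p * x * p)"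
        using expand[OF xB] by simp
      also have "\<dots> \<in> D"
      proof (rule complex_vector.subspace_sum[OF D_closed(1)])
        fix p assume "p \<in> P"
        then show "p * x * p \<in> D"
          using corner_scalar[OF xB] D_closed(6) P_facts(4) by metis
      qed
      finally show "x \<in> D" .
    qed
  qed
  have "T' = T"
    by (rule T_max) (use T'_sub T'_mult T'_D T_T' in \<open>auto simp: T'_def subalgebra_def\<close>)
  moreover have "y \<in> T'"
  proof -
    have "R' p r" if p: "p \<in> P" and r: "r \<in> P" and ne: "p * y * r \<noteq> 0" for p r
    proof -
      have "p * y * r = (p * q) * y * (s * r)" using y by (metis mult.assoc)
      then have "p = q" "s = r" using ne P_orthogonal p r qs by (metis mult_zero_left mult_zero_right)+
      then show ?thesis using R_refl qs by (simp add: R'_def)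
    qed
    then show ?thesis using y by (simp add: T'_def)
  qed
  ultimately show False using no by blast
qed

end

section \<open>Closed diagonal bimodules are inductive\<close>

lemma norm_mult3_le:
  fixes x y z :: "'b::real_normed_algebra"
  assumes "norm x \<le> a" "norm y \<le> b" "norm z \<le> c" "0 \<le> a" "0 \<le> b"
  shows "norm (x * y * z) \<le> a * b * c"
proof -
  have "norm (x * y) \<le> a * b" using assms norm_mult_ineq[of x y] mult_mono[OF assms(1,2)] by fastforce
  then show ?thesis
    using assms norm_mult_ineq[of "x * y" z] mult_mono[of "norm (x * y)" "a * b" "norm z" c] by fastforce
qed

lemma norm_projection_eq_1: "projection p \<Longrightarrow> p \<noteq> 0 \<Longrightarrow> norm p = 1"
  using cstar_identity[of p] by (simp add: projection_def power2_eq_square)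

lemma normalizer_partial_isometry: "w \<in> normalizer B D \<Longrightarrow> partial_isometry w"
  by (simp add: normalizer_def)

lemma (in diagonal_frame) projection_below:
  assumes e: "e \<in> D" "projection e"
  shows "u \<in> P \<Longrightarrow> e * u = u \<or> e * u = 0" "\<Sum>{u\<in>P. e * u = u} = e"
proof -
  show *: "e * u = u \<or> e * u = 0" if u: "u \<in> P" for u
  proof -
    obtain c where c: "e * u = c *\<^sub>C u" using diagonal_scalar[OF e(1) u] by blast
    have "c *\<^sub>C c *\<^sub>C u = e * (e * u)" using c by (simp add: mult_scaleC_right)
    also have "\<dots> = (e * e) * u" by (simp only: mult.assoc)
    also have "\<dots> = c *\<^sub>C u" using e(2) c by (simp add: projection_def)
    finally have "(c * c - c) *\<^sub>C u = 0"
      by (simp add: scaleC_scaleC complex_vector.scale_left_diff_distrib)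
    then have "c * (c - 1) = 0" using P_facts(3)[OF u] by (simp add: algebra_simps)
    then show ?thesis using c by auto
  qed
  have "e = (\<Sum>u\<in>P. e * u)" using expand_right e(1) D_sub_B by blast
  also have "\<dots> = (\<Sum>u\<in>{u\<in>P. e * u = u}. e * u)"
    using finite_P * by (intro sum.mono_neutral_right) auto
  also have "\<dots> = \<Sum>{u\<in>P. e * u = u}" by simp
  finally show "\<Sum>{u\<in>P. e * u = u} = e" by simp
qed

definition closed_bimodule :: "'b::cstar_algebra set \<Rightarrow> 'b set \<Rightarrow> bool" where
  "closed_bimodule D S \<longleftrightarrow> complex_vector.subspace S \<and> closed S \<and>
     (\<forall>d\<in>D. \<forall>x\<in>S. d * x \<in> S \<and> x * d \<in> S)"

text \<open>\<open>P n\<close> consists of the minimal projections of \<open>D \<inter> Bs n\<close>.\<close>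

locale AF_frame =
  fixes Bs :: "nat \<Rightarrow> 'b::cstar_algebra set" and D :: "'b set" and P :: "nat \<Rightarrow> 'b set"
  assumes AF: "AF_canonical_masa Bs D" and frame: "diagonal_frame (Bs n) (D \<inter> Bs n) (P n)"

lemma AF_canonical_masa_frame:
  assumes "AF_canonical_masa Bs D" obtains P where "AF_frame Bs D P"
proof -
  have "\<forall>n. \<exists>P. diagonal_frame (Bs n) (D \<inter> Bs n) P"
    using assms masa_diagonal_frame unfolding AF_canonical_masa_def by blast
  then obtain P where "\<And>n. diagonal_frame (Bs n) (D \<inter> Bs n) (P n)" by metis
  then show ?thesis using that assms by (auto simp: AF_frame_def)
qed

context AF_frame
begin

lemma Bs_mono: "n \<le> m \<Longrightarrow> Bs n \<subseteq> Bs m"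
  by (rule lift_Suc_mono_le[of Bs]) (use AF in \<open>auto simp: AF_canonical_masa_def\<close>)

lemma normalizer_mono: "n \<le> m \<Longrightarrow> normalizer (Bs n) (D \<inter> Bs n) \<subseteq> normalizer (Bs m) (D \<inter> Bs m)"
  by (rule lift_Suc_mono_le[of "\<lambda>n. normalizer (Bs n) (D \<inter> Bs n)"])
    (use AF in \<open>auto simp: AF_canonical_masa_def\<close>)

lemma Bs_dense:
  assumes "\<epsilon> > 0" obtains m c where "m \<ge> n" "c \<in> Bs m" "norm (x - c) < \<epsilon>"
proof -
  have "x \<in> closure (\<Union>i. Bs i)" using AF by (simp add: AF_canonical_masa_def)
  then obtain c where "c \<in> (\<Union>i. Bs i)" "dist c x < \<epsilon>"
    using assms unfolding closure_approachable by blast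
  then obtain i where "c \<in> Bs i" "norm (x - c) < \<epsilon>" by (auto simp: dist_norm norm_minus_commute)
  then show ?thesis using that[of "max n i" c] Bs_mono[of i "max n i"] by auto
qed

text \<open>
  If \<open>s \<in> S\<close> is close to \<open>\<mu> v\<close>, then \<open>v\<^sup>*s\<close> is close to the multiple \<open>\<mu> v\<^sup>*v\<close> of a projection.
  Its pinching \<open>x\<close> along fine diagonal projections is nearly diagonal, hence nearly equal to some
  invertible \<open>d\<close> in \<open>D v\<^sup>*v\<close>; so \<open>v x d\<^sup>-\<^sup>1\<close>, which belongs to \<open>S\<close> because \<open>v\<close> normalizes \<open>D\<close>,
  is nearly \<open>v\<close>.
\<close>

lemma normalizer_mem_bimodule:
  assumes S: "closed_bimodule D S" and v: "v \<in> normalizer (Bs m) (D \<inter> Bs m)"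
    and s: "s \<in> S" "norm (s - \<mu> *\<^sub>C v) \<le> \<delta>" and \<delta>: "2 * \<delta> < cmod \<mu>"
  shows "v \<in> S"
proof -
  interpret m: diagonal_frame "Bs m" "D \<inter> Bs m" "P m" by (rule frame)
  have S_sub: "complex_vector.subspace S" and S_closed: "closed S"
    and S_mult: "\<And>d x. d \<in> D \<Longrightarrow> x \<in> S \<Longrightarrow> d * x \<in> S" "\<And>d x. d \<in> D \<Longrightarrow> x \<in> S \<Longrightarrow> x * d \<in> S"
    using S by (auto simp: closed_bimodule_def)
  have vB: "v \<in> Bs m" and vpi: "v * adj v * v = v" and v1: "norm v \<le> 1"
    and vDv: "\<And>d. d \<in> D \<inter> Bs m \<Longrightarrow> adj v * d * v \<in> D \<inter> Bs m"
    using v norm_partial_isometry_le_1 by (auto simp: normalizer_def partial_isometry_def)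
  have \<delta>0: "0 \<le> \<delta>" using s(2) norm_ge_zero order_trans by blast
  have \<mu>0: "cmod \<mu> > 0" using \<delta> \<delta>0 by linarith
  let ?h = "adj v * v"
  have hD: "?h \<in> D \<inter> Bs m"
    using vDv[OF m.unit_in_D] m.unit_left[OF vB] by (simp add: mult.assoc)
  have hp: "projection ?h"
    using vpi by (simp add: projection_def adj_mult adj_adj mult.assoc)
  have vh: "v * ?h = v" using vpi by (simp add: mult.assoc)
  have "\<exists>y\<in>S. dist y v < \<epsilon>" if \<epsilon>: "\<epsilon> > 0" for \<epsilon>
  proof -
    \<comment> \<open>The first bound keeps the coefficients of \<open>d\<close> at least \<open>cmod \<mu> / 2\<close> in modulus, whence
      \<open>norm d' \<le> 2 / cmod \<mu>\<close>; the second then makes the final error smaller than \<open>\<epsilon>\<close>.\<close>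
    define \<eta> where "\<eta> = min (cmod \<mu> / 2 - \<delta>) (\<epsilon> * cmod \<mu> / 4)"
    have \<eta>: "\<eta> > 0" "\<delta> + \<eta> \<le> cmod \<mu> / 2" "\<eta> \<le> \<epsilon> * cmod \<mu> / 4"
      using \<delta> \<epsilon> \<mu>0 by (auto simp: \<eta>_def min_def)
    obtain k c where k: "k \<ge> m" and c: "c \<in> Bs k" "norm (adj v * s - c) < \<eta>"
      using Bs_dense[OF \<eta>(1)] by blast
    interpret k: diagonal_frame "Bs k" "D \<inter> Bs k" "P k" by (rule frame)
    have vk: "v \<in> normalizer (Bs k) (D \<inter> Bs k)" using v normalizer_mono[OF k] by blast
    have hDk: "?h \<in> D \<inter> Bs k" using hD Bs_mono[OF k] by blast
    define U where "U = {u\<in>P k. ?h * u = u}"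
    have U: "U \<subseteq> P k" "finite U" using k.finite_P by (auto simp: U_def)
    have U_orth: "orthogonal_projections U" by (rule orthogonal_projections_subset[OF k.orthogonal U(1)])
    have sumU: "\<Sum>U = ?h" unfolding U_def by (rule k.projection_below(2)[OF hDk hp])
    have "\<forall>u. \<exists>g. u \<in> U \<longrightarrow> u * c * u = g *\<^sub>C u" using k.corner_scalar[OF c(1)] U(1) by blast
    then obtain \<gamma> where \<gamma>: "\<And>u. u \<in> U \<Longrightarrow> u * c * u = \<gamma> u *\<^sub>C u" by metis
    define x where "x = (\<Sum>u\<in>U. u * (adj v * s) * u)"
    define d where "d = (\<Sum>u\<in>U. \<gamma> u *\<^sub>C u)"
    define d' where "d' = (\<Sum>u\<in>U. (1 / \<gamma> u) *\<^sub>C u)"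
    have xd: "norm (x - d) \<le> \<eta>"
    proof -
      have "x - d = (\<Sum>u\<in>U. u * (adj v * s - c) * u)"
        unfolding x_def d_def sum_subtractf[symmetric]
        by (intro sum.cong refl) (simp add: right_diff_distrib left_diff_distrib flip: \<gamma>)
      then show ?thesis using norm_pinching_le[OF U_orth, of "adj v * s - c"] c(2) by simp
    qed
    have \<gamma>_ge: "cmod (\<gamma> u) \<ge> cmod \<mu> / 2" if u: "u \<in> U" for u
    proof -
      have uP: "u \<in> P k" and hu: "?h * u = u" using u by (auto simp: U_def)
      have u1: "norm u = 1" using norm_projection_eq_1 k.P_facts uP by blast
      have "u * adj v * (s - \<mu> *\<^sub>C v) * u = u * (adj v * s) * u - \<mu> *\<^sub>C (u * (?h * u))"
        by (simp add: algebra_simps mult_scaleC_left mult_scaleC_right)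
      also have "\<dots> = u * (adj v * s) * u - \<mu> *\<^sub>C u" using hu k.P_facts(1)[OF uP] by simp
      finally have e: "u * adj v * (s - \<mu> *\<^sub>C v) * u = u * (adj v * s) * u - \<mu> *\<^sub>C u" .
      have "norm (u * adj v) \<le> 1"
        using norm_mult_ineq[of u "adj v"] u1 v1 by (simp add: norm_adj)
      then have "norm (u * adj v * (s - \<mu> *\<^sub>C v) * u) \<le> 1 * \<delta> * 1"
        using u1 s(2) \<delta>0 by (intro norm_mult3_le) auto
      then have 1: "norm (u * (adj v * s) * u - \<mu> *\<^sub>C u) \<le> \<delta>" unfolding e by simp
      have "norm (u * (adj v * s - c) * u) \<le> 1 * \<eta> * 1"
        using u1 c(2) \<eta>(1) by (intro norm_mult3_le) auto
      then have 2: "norm (u * (adj v * s) * u - \<gamma> u *\<^sub>C u) \<le> \<eta>"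
        using \<gamma>[OF u] by (simp add: right_diff_distrib left_diff_distrib)
      have "norm ((\<gamma> u - \<mu>) *\<^sub>C u) \<le> \<delta> + \<eta>"
        using norm_triangle_ineq4[of "u * (adj v * s) * u - \<mu> *\<^sub>C u" "u * (adj v * s) * u - \<gamma> u *\<^sub>C u"] 1 2
        by (simp add: complex_vector.scale_left_diff_distrib)
      then have "cmod (\<mu> - \<gamma> u) \<le> cmod \<mu> / 2" using u1 \<eta>(2) by (simp add: norm_scaleC norm_minus_commute)
      then show ?thesis using norm_triangle_ineq2[of \<mu> "\<gamma> u"] by linarith
    qed
    then have \<gamma>0: "\<gamma> u \<noteq> 0" if "u \<in> U" for u using that \<mu>0 by fastforce
    have d'_norm: "norm d' \<le> 2 / cmod \<mu>"
      unfolding d'_def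
    proof (rule norm_diagonal_le[OF U_orth])
      fix u assume u: "u \<in> U"
      have "cmod (1 / \<gamma> u) \<le> 1 / (cmod \<mu> / 2)"
        unfolding norm_divide norm_one using \<gamma>_ge[OF u] \<gamma>0[OF u] \<mu>0 by (intro divide_left_mono) auto
      then show "cmod (1 / \<gamma> u) \<le> 2 / cmod \<mu>" by simp
    qed (use \<mu>0 in auto)
    have "d * d' = (\<Sum>u\<in>U. (1 / \<gamma> u) *\<^sub>C (d * u))"
      by (simp add: d'_def sum_distrib_left mult_scaleC_right)
    also have "\<dots> = (\<Sum>u\<in>U. u)"
      unfolding d_def using sum_mult_orthogonal(1)[OF U_orth] \<gamma>0 by (intro sum.cong) (simp_all add: scaleC_scaleC)
    finally have dd': "d * d' = ?h" using sumU by simp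
    have UD: "u \<in> D" if "u \<in> U" for u using k.P_facts(4) that U(1) by blast
    have d'D: "d' \<in> D"
    proof -
      have "d' \<in> D \<inter> Bs k" unfolding d'_def
        by (intro complex_vector.subspace_sum complex_vector.subspace_scale k.D_closed(1))
          (use k.P_facts(4) U(1) in blast)
      then show ?thesis by simp
    qed
    have vuv: "v * u * adj v \<in> D" if "u \<in> U" for u
      using vk k.P_facts(4) that U(1) unfolding normalizer_def by blast
    have "v * x = (\<Sum>u\<in>U. (v * u * adj v) * s * u)"
      by (simp add: x_def sum_distrib_left mult.assoc)
    also have "\<dots> \<in> S"
      by (intro complex_vector.subspace_sum[OF S_sub] S_mult vuv UD s(1))
    finally have "v * x * d' \<in> S" by (rule S_mult(2)[OF d'D])
    moreover have "dist (v * x * d') v < \<epsilon>"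
    proof -
      have "v * (x - d) * d' = v * x * d' - v * (d * d')" by (simp add: algebra_simps)
      then have "v * (x - d) * d' = v * x * d' - v" using dd' vh by simp
      moreover have "norm (v * (x - d) * d') \<le> 1 * \<eta> * (2 / cmod \<mu>)"
        using v1 xd d'_norm \<eta>(1) by (intro norm_mult3_le) auto
      moreover have "\<eta> * (2 / cmod \<mu>) \<le> \<epsilon> * cmod \<mu> / 4 * (2 / cmod \<mu>)"
        using \<eta>(3) \<mu>0 by (intro mult_right_mono) auto
      moreover have "\<epsilon> * cmod \<mu> / 4 * (2 / cmod \<mu>) < \<epsilon>" using \<mu>0 \<epsilon> by simp
      ultimately show ?thesis by (simp add: dist_norm)
    qed
    ultimately show ?thesis by blast
  qed
  then have "v \<in> closure S" by (simp add: closure_approachable)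
  then show ?thesis using S_closed by simp
qed

text \<open>
  Pinching along the projections \<open>r t\<close>, which commute with the matrix units \<open>w p (w q)\<^sup>*\<close> of \<open>Bs n\<close>,
  is a contraction that fixes \<open>Bs n\<close>, no matter how large \<open>m\<close> is. It maps \<open>c \<in> Bs m\<close>, which
  approximates \<open>a \<in> S\<close>, to a combination of the \<open>w p t (w q)\<^sup>*\<close>. Those with a coefficient that is
  large compared with \<open>norm (a - c)\<close> belong to \<open>S\<close>; the others add up to something small, because
  the number of pairs \<open>(p, q)\<close> does not depend on \<open>m\<close>.
\<close>

theorem closed_bimodule_inductive:
  assumes S: "closed_bimodule D S" and a: "a \<in> S" and \<epsilon>: "\<epsilon> > 0"
  obtains m s where "s \<in> S \<inter> Bs m" "norm (s - a) < \<epsilon>"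
proof -
  have S_sub: "complex_vector.subspace S"
    and S_mult: "\<And>d x. d \<in> D \<Longrightarrow> x \<in> S \<Longrightarrow> d * x \<in> S" "\<And>d x. d \<in> D \<Longrightarrow> x \<in> S \<Longrightarrow> x * d \<in> S"
    using S by (auto simp: closed_bimodule_def)
  obtain n b where b: "b \<in> Bs n" "norm (a - b) < \<epsilon> / 4"
    using Bs_dense[of "\<epsilon> / 4"] \<epsilon> by (metis divide_pos_pos zero_less_numeral)
  interpret n: diagonal_frame "Bs n" "D \<inter> Bs n" "P n" by (rule frame)
  obtain w \<beta> where
    w_all: "\<And>p. p \<in> P n \<Longrightarrow> \<beta> p \<in> P n \<and> w p \<in> Bs n \<and> p * w p = w p \<and> w p * \<beta> p = w p \<and>
       w p * adj (w p) = p \<and> adj (w p) * w p = \<beta> p"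
    and w_span: "\<And>x p q. x \<in> Bs n \<Longrightarrow> p \<in> P n \<Longrightarrow> q \<in> P n \<Longrightarrow> \<exists>c. p * x * q = c *\<^sub>C (w p * adj (w q))"
    using n.matrix_units by metis
  define N where "N = real (card (P n))"
  \<comment> \<open>There are \<open>N * N\<close> pairs \<open>(p, q)\<close>, and the small coefficients of each contribute at most \<open>2 * \<delta>\<close>.\<close>
  define \<delta> where "\<delta> = \<epsilon> / (8 * (N * N + 1))"
  have NN: "N * N + 1 > 0" by (simp add: N_def add_nonneg_pos)
  have \<delta>: "\<delta> > 0" "N * (N * (2 * \<delta>)) \<le> \<epsilon> / 4" "\<delta> \<le> \<epsilon> / 8"
    using \<epsilon> NN by (simp_all add: \<delta>_def N_def field_simps)
  obtain m c where m: "m \<ge> n" and c: "c \<in> Bs m" "norm (a - c) < \<delta>"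
    using Bs_dense[OF \<delta>(1)] by blast
  interpret m: diagonal_frame "Bs m" "D \<inter> Bs m" "P m" by (rule frame)
  have w: "\<beta> p \<in> P n" "w p \<in> Bs n" "p * w p = w p" "w p * \<beta> p = w p" "w p * adj (w p) = p"
    "adj (w p) * w p = \<beta> p" if "p \<in> P n" for p
    using w_all[OF that] by auto
  have aw: "adj (w p) * p = adj (w p)" "\<beta> p * adj (w p) = adj (w p)" if "p \<in> P n" for p
    using w[OF that] n.P_facts(2) that by (metis adj_mult)+
  have wm: "w p \<in> Bs m" if "p \<in> P n" for p using w(2)[OF that] Bs_mono[OF m] by blast
  have \<beta>D: "\<beta> p \<in> D \<inter> Bs m" if "p \<in> P n" for p
    using n.P_facts(4)[OF w(1)[OF that]] Bs_mono[OF m] by blast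
  have w_norm: "w p \<in> normalizer (Bs m) (D \<inter> Bs m)" if p: "p \<in> P n" for p
    using n.partial_isometry_normalizes[OF w(2-6)[OF p] p w(1)[OF p]] normalizer_mono[OF m] by blast
  have wDw: "w p * d * adj (w p) \<in> D \<inter> Bs m" "adj (w p) * d * w p \<in> D \<inter> Bs m"
    if "p \<in> P n" "d \<in> D \<inter> Bs m" for p d
    using w_norm[OF that(1)] that(2) unfolding normalizer_def by blast+
  have ww: "adj (w p) * w q = (if p = q then \<beta> p else 0)" if p: "p \<in> P n" and q: "q \<in> P n" for p q
  proof (cases "p = q")
    case False
    have "adj (w p) * w q = adj (w p) * (p * q) * w q" using aw(1)[OF p] w(3)[OF q] by (metis mult.assoc)
    then show ?thesis using n.P_orthogonal[OF p q False] False by simp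
  qed (use w(6)[OF p] in simp)
  have tD: "t \<in> D \<inter> Bs m" "t * t = t" "adj t = t" if "t \<in> P m" for t using m.P_facts[OF that] by auto
  have t\<beta>: "t * \<beta> p = \<beta> p * t" if "t \<in> P m" "p \<in> P n" for t p
    by (rule m.D_commute[OF tD(1)[OF that(1)] \<beta>D[OF that(2)]])
  have wt\<beta>: "w p * t * \<beta> p = w p * t" if p: "p \<in> P n" and t: "t \<in> P m" for p t
    using t\<beta>[OF t p] w(4)[OF p] by (metis mult.assoc)
  define g where "g p t = w p * t * adj (w p)" for p t
  have gD: "g p t \<in> D \<inter> Bs m" if "p \<in> P n" "t \<in> P m" for p t
    unfolding g_def by (rule wDw(1)[OF that(1) tD(1)[OF that(2)]])
  have gg: "g p t * g q t' = (if p = q \<and> t = t' then g p t else 0)"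
    if p: "p \<in> P n" and q: "q \<in> P n" and t: "t \<in> P m" and t': "t' \<in> P m" for p q t t'
  proof (cases "p = q")
    case True
    have "g p t * g q t' = w p * t * (adj (w p) * w p) * t' * adj (w p)"
      by (simp add: g_def mult.assoc True)
    also have "\<dots> = w p * (t * t') * adj (w p)"
      unfolding w(6)[OF p] wt\<beta>[OF p t] by (simp add: mult.assoc)
    finally show ?thesis
      using True m.P_orthogonal[OF t t'] tD(2)[OF t] by (auto simp: g_def)
  next
    case False
    have "g p t * g q t' = w p * t * (adj (w p) * w q) * t' * adj (w q)"
      by (simp add: g_def mult.assoc)
    then show ?thesis using ww[OF p q] False by simp
  qed
  have g_proj: "projection (g p t)" if p: "p \<in> P n" and t: "t \<in> P m" for p t
  proof -
    have "adj (g p t) = g p t" using tD(3)[OF t] by (simp add: g_def adj_mult adj_adj mult.assoc)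
    then show ?thesis using gg[OF p p t t] by (simp add: projection_def)
  qed
  define r where "r t = (\<Sum>p\<in>P n. g p t)" for t
  have rD: "r t \<in> D" if "t \<in> P m" for t
    using complex_vector.subspace_sum[OF m.D_closed(1), of "P n" "\<lambda>p. g p t"] gD that
    by (auto simp: r_def)
  have r_w: "r t * w p = w p * t" if p: "p \<in> P n" and t: "t \<in> P m" for p t
  proof -
    have "r t * w p = (\<Sum>q\<in>P n. w q * t * (adj (w q) * w p))"
      by (simp add: r_def g_def sum_distrib_right mult.assoc)
    also have "\<dots> = (\<Sum>q\<in>P n. if q = p then w p * t * \<beta> p else 0)"
      using ww p by (intro sum.cong) auto
    also have "\<dots> = w p * t" using p n.finite_P wt\<beta>[OF p t] by simp
    finally show ?thesis .
  qed
  have r_adj: "adj (r t) = r t" if "t \<in> P m" for t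
    using g_proj that by (simp add: r_def adj_sum projection_def)
  have rr: "r t * r t' = (if t = t' then r t else 0)" if t: "t \<in> P m" and t': "t' \<in> P m" for t t'
  proof -
    have "r t * r t' = (\<Sum>p\<in>P n. \<Sum>q\<in>P n. g p t * g q t')" by (simp add: r_def sum_product)
    also have "\<dots> = (\<Sum>p\<in>P n. \<Sum>q\<in>P n. if q = p then (if t = t' then g p t else 0) else 0)"
      using gg t t' by (intro sum.cong refl) auto
    also have "\<dots> = (if t = t' then r t else 0)" using n.finite_P by (simp add: r_def)
    finally show ?thesis .
  qed
  have r_orth: "orthogonal_projections (r ` P m)"
    using m.finite_P rr r_adj unfolding orthogonal_projections_def projection_def by auto
  define \<Psi> where "\<Psi> x = (\<Sum>t\<in>P m. r t * x * r t)" for x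
  have \<Psi>_diff: "\<Psi> (x - y) = \<Psi> x - \<Psi> y" for x y
    by (simp add: \<Psi>_def algebra_simps sum_subtractf)
  have \<Psi>_norm: "norm (\<Psi> x) \<le> norm x" for x
  proof -
    have "(\<Sum>s\<in>r ` P m. s * x * s) = sum ((\<lambda>s. s * x * s) \<circ> r) (P m)"
    proof (rule sum.reindex_nontrivial[OF m.finite_P])
      fix t t' assume "t \<in> P m" "t' \<in> P m" "t \<noteq> t'" "r t = r t'"
      then have "r t = 0" using rr[of t t'] rr[of t t] by simp
      then show "r t * x * r t = 0" by simp
    qed
    then show ?thesis using norm_pinching_le[OF r_orth, of x] by (simp add: \<Psi>_def)
  qed
  have \<Psi>_b: "\<Psi> b = b"
  proof -
    have comm: "r t * b = b * r t" if t: "t \<in> P m" for t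
    proof -
      have rw: "r t * (p * b * q) = p * b * q * r t" if p: "p \<in> P n" and q: "q \<in> P n" for p q
      proof -
        obtain k where k: "p * b * q = k *\<^sub>C (w p * adj (w q))" using w_span[OF b(1) p q] by blast
        have "adj (r t * w q) = adj (w q * t)" using r_w[OF q t] by simp
        then have "adj (w q) * r t = t * adj (w q)" using r_adj[OF t] tD(3)[OF t] by (simp add: adj_mult)
        then have "w p * adj (w q) * r t = w p * t * adj (w q)" by (simp add: mult.assoc)
        moreover have "r t * (w p * adj (w q)) = w p * t * adj (w q)"
          using r_w[OF p t] by (simp flip: mult.assoc)
        ultimately show ?thesis by (simp add: k mult_scaleC_left mult_scaleC_right)
      qed
      let ?e = "\<Sum>p\<in>P n. \<Sum>q\<in>P n. p * b * q"
      have "r t * ?e = ?e * r t"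
        unfolding sum_distrib_left sum_distrib_right using rw by (intro sum.cong refl)
      then show ?thesis using n.expand[OF b(1)] by simp
    qed
    have sum_r: "(\<Sum>t\<in>P m. r t) = \<Sum>(P n)"
    proof -
      have "(\<Sum>t\<in>P m. r t) = (\<Sum>p\<in>P n. \<Sum>t\<in>P m. g p t)" unfolding r_def by (rule sum.swap)
      also have "\<dots> = (\<Sum>p\<in>P n. w p * \<Sum>(P m) * adj (w p))"
        by (simp add: g_def sum_distrib_left sum_distrib_right)
      also have "\<dots> = \<Sum>(P n)" using m.unit_right[OF wm] w(5) by (intro sum.cong) simp_all
      finally show ?thesis .
    qed
    have "\<Psi> b = (\<Sum>t\<in>P m. b * r t)"
      unfolding \<Psi>_def
    proof (rule sum.cong[OF refl])
      fix t assume t: "t \<in> P m"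
      show "r t * b * r t = b * r t" using comm[OF t] rr[OF t t] by (simp add: mult.assoc)
    qed
    then show ?thesis using sum_r n.unit_right[OF b(1)] by (simp flip: sum_distrib_left)
  qed
  define \<mu> where "\<mu> p q t = (SOME k. t * (adj (w p) * c * w q) * t = k *\<^sub>C t)" for p q t
  have \<mu>: "t * (adj (w p) * c * w q) * t = \<mu> p q t *\<^sub>C t"
    if p: "p \<in> P n" and q: "q \<in> P n" and t: "t \<in> P m" for p q t
  proof -
    have "\<exists>k. t * (adj (w p) * c * w q) * t = k *\<^sub>C t"
      by (intro m.corner_scalar m.B_closed(3,7) wm c(1) p q t)
    then show ?thesis unfolding \<mu>_def by (rule someI_ex)
  qed
  define v where "v p q t = w p * t * adj (w q)" for p q t
  have gcg: "g p t * c * g q t = \<mu> p q t *\<^sub>C v p q t" if "p \<in> P n" "q \<in> P n" "t \<in> P m" for p q t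
  proof -
    have "g p t * c * g q t = w p * (t * (adj (w p) * c * w q) * t) * adj (w q)"
      by (simp add: g_def mult.assoc)
    then show ?thesis using \<mu>[OF that] by (simp add: v_def mult_scaleC_left mult_scaleC_right)
  qed
  have vB: "v p q t \<in> Bs m" if "p \<in> P n" "q \<in> P n" "t \<in> P m" for p q t
    unfolding v_def using that by (intro m.B_closed wm m.P_facts)
  have v_norm: "v p q t \<in> normalizer (Bs m) (D \<inter> Bs m)"
    if p: "p \<in> P n" and q: "q \<in> P n" and t: "t \<in> P m" for p q t
  proof -
    have av: "adj (v p q t) = v q p t" using tD(3)[OF t] by (simp add: v_def adj_mult adj_adj mult.assoc)
    have conj: "v p q t * d * v q p t \<in> D \<inter> Bs m"
      if p: "p \<in> P n" and q: "q \<in> P n" and d: "d \<in> D \<inter> Bs m" for p q d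
    proof -
      have "v p q t * d * v q p t = w p * (t * (adj (w q) * d * w q) * t) * adj (w p)"
        by (simp add: v_def mult.assoc)
      also have "\<dots> \<in> D \<inter> Bs m"
        by (intro wDw(1)[OF p] m.D_closed(3) tD(1)[OF t] wDw(2)[OF q] d)
      finally show ?thesis .
    qed
    have "v p q t * v q p t * v p q t
        = w p * t * (adj (w q) * w q) * t * (adj (w p) * w p) * t * adj (w q)"
      by (simp add: v_def mult.assoc)
    also have "\<dots> = w p * t * \<beta> q * t * \<beta> p * t * adj (w q)" using w(6) p q by simp
    also have "\<dots> = w p * t * \<beta> q * (t * \<beta> p) * t * adj (w q)" by (simp only: mult.assoc)
    also have "\<dots> = w p * t * (\<beta> q * \<beta> p) * (t * t) * adj (w q)"
      unfolding t\<beta>[OF t p] by (simp only: mult.assoc)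
    also have "\<dots> = w p * t * \<beta> p * (\<beta> q * t) * adj (w q)"
      unfolding m.D_commute[OF \<beta>D[OF q] \<beta>D[OF p]] tD(2)[OF t] by (simp only: mult.assoc)
    also have "\<dots> = w p * (t * t) * (\<beta> q * adj (w q))"
      unfolding wt\<beta>[OF p t] t\<beta>[OF t q, symmetric] by (simp only: mult.assoc)
    also have "\<dots> = v p q t" unfolding aw(2)[OF q] tD(2)[OF t] v_def ..
    finally have "partial_isometry (v p q t)" by (simp add: partial_isometry_def av)
    then show ?thesis
      using vB[OF p q t] conj[OF p q] conj[OF q p] by (simp add: normalizer_def av)
  qed
  have vS: "v p q t \<in> S" if p: "p \<in> P n" and q: "q \<in> P n" and t: "t \<in> P m" and big: "2 * \<delta> < cmod (\<mu> p q t)" for p q t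
  proof (rule normalizer_mem_bimodule[OF S v_norm[OF p q t] _ _ big])
    show "g p t * a * g q t \<in> S" using gD p q t a S_mult by blast
    have "g p t * a * g q t - \<mu> p q t *\<^sub>C v p q t = g p t * (a - c) * g q t"
      using gcg[OF p q t] by (simp add: algebra_simps)
    moreover have "norm (g p t * (a - c) * g q t) \<le> 1 * \<delta> * 1"
      using g_proj p q t c(2) \<delta>(1) by (intro norm_mult3_le norm_projection_le_1) auto
    ultimately show "norm (g p t * a * g q t - \<mu> p q t *\<^sub>C v p q t) \<le> \<delta>" by simp
  qed
  define big where "big p q = {t\<in>P m. 2 * \<delta> < cmod (\<mu> p q t)}" for p q
  define s where "s = (\<Sum>p\<in>P n. \<Sum>q\<in>P n. \<Sum>t\<in>big p q. \<mu> p q t *\<^sub>C v p q t)"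
  have sS: "s \<in> S" unfolding s_def
    by (intro complex_vector.subspace_sum[OF S_sub] complex_vector.subspace_scale[OF S_sub] vS)
      (auto simp: big_def)
  have sB: "s \<in> Bs m" unfolding s_def
    by (intro complex_vector.subspace_sum[OF m.B_closed(1)] complex_vector.subspace_scale[OF m.B_closed(1)] vB)
      (auto simp: big_def)
  have "\<Psi> c = (\<Sum>t\<in>P m. \<Sum>p\<in>P n. \<Sum>q\<in>P n. g p t * c * g q t)"
    by (simp only: \<Psi>_def r_def sum_distrib_right[where r = c] sum_product)
  also have "\<dots> = (\<Sum>t\<in>P m. \<Sum>p\<in>P n. \<Sum>q\<in>P n. \<mu> p q t *\<^sub>C v p q t)"
    by (intro sum.cong refl gcg)
  also have "\<dots> = (\<Sum>p\<in>P n. \<Sum>t\<in>P m. \<Sum>q\<in>P n. \<mu> p q t *\<^sub>C v p q t)"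
    by (rule sum.swap)
  also have "\<dots> = (\<Sum>p\<in>P n. \<Sum>q\<in>P n. \<Sum>t\<in>P m. \<mu> p q t *\<^sub>C v p q t)"
    by (rule sum.cong[OF refl], rule sum.swap)
  also have "\<dots> = (\<Sum>p\<in>P n. \<Sum>q\<in>P n. (\<Sum>t\<in>P m - big p q. \<mu> p q t *\<^sub>C v p q t) +
      (\<Sum>t\<in>big p q. \<mu> p q t *\<^sub>C v p q t))"
    by (intro sum.cong refl sum.subset_diff m.finite_P) (auto simp: big_def)
  finally have "\<Psi> c - s = (\<Sum>p\<in>P n. \<Sum>q\<in>P n. \<Sum>t\<in>P m - big p q. \<mu> p q t *\<^sub>C v p q t)"
    by (simp add: s_def sum.distrib)
  also have "norm \<dots> \<le> N * (N * (2 * \<delta>))"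
    unfolding N_def
  proof (intro sum_norm_bound)
    fix p q assume p: "p \<in> P n" and q: "q \<in> P n"
    let ?d = "\<Sum>t\<in>P m - big p q. \<mu> p q t *\<^sub>C t"
    have "(\<Sum>t\<in>P m - big p q. \<mu> p q t *\<^sub>C v p q t) = w p * ?d * adj (w q)"
      by (simp add: v_def sum_distrib_left sum_distrib_right mult_scaleC_left mult_scaleC_right)
    moreover have "norm ?d \<le> 2 * \<delta>"
      by (rule norm_diagonal_le[OF orthogonal_projections_subset[OF m.orthogonal]])
        (use \<delta>(1) in \<open>auto simp: big_def\<close>)
    then have "norm (w p * ?d * adj (w q)) \<le> 1 * (2 * \<delta>) * 1"
      using norm_partial_isometry_le_1[OF normalizer_partial_isometry[OF w_norm]] p q \<delta>(1)
      by (intro norm_mult3_le) (auto simp: norm_adj)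
    ultimately show "norm (\<Sum>t\<in>P m - big p q. \<mu> p q t *\<^sub>C v p q t) \<le> 2 * \<delta>" by simp
  qed
  finally have 1: "norm (\<Psi> c - s) \<le> \<epsilon> / 4" using \<delta>(2) by linarith
  have 2: "norm (\<Psi> a - \<Psi> c) \<le> \<epsilon> / 8"
    using \<Psi>_norm[of "a - c"] \<Psi>_diff[of a c] c(2) \<delta>(3) by simp
  have 3: "norm (\<Psi> a - b) \<le> \<epsilon> / 4"
    using \<Psi>_norm[of "a - b"] \<Psi>_diff[of a b] \<Psi>_b b(2) by simp
  have "s - a = - (\<Psi> c - s) - (\<Psi> a - \<Psi> c) + (\<Psi> a - b) - (a - b)" by simp
  then have "norm (s - a) \<le> norm (\<Psi> c - s) + norm (\<Psi> a - \<Psi> c) + norm (\<Psi> a - b) + norm (a - b)"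
    using norm_triangle_ineq4[of "- (\<Psi> c - s) - (\<Psi> a - \<Psi> c) + (\<Psi> a - b)" "a - b"]
      norm_triangle_ineq[of "- (\<Psi> c - s) - (\<Psi> a - \<Psi> c)" "\<Psi> a - b"]
      norm_triangle_ineq4[of "- (\<Psi> c - s)" "\<Psi> a - \<Psi> c"] by (simp only: norm_minus_cancel)
  then have "norm (s - a) < \<epsilon>" using 1 2 3 b(2) \<epsilon> by linarith
  then show ?thesis using that sS sB by blast
qed

end

section \<open>Representations\<close>

lemma closure_complex_subspace:
  fixes S :: "'b::complex_normed_vector set"
  assumes S: "complex_vector.subspace S" shows "complex_vector.subspace (closure S)"
proof (rule complex_vector.subspaceI)
  show "0 \<in> closure S" using complex_vector.subspace_0[OF S] closure_subset by blast
next
  fix x y assume "x \<in> closure S" "y \<in> closure S"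
  then obtain f g where f: "\<And>n. f n \<in> S" "f \<longlonglongrightarrow> x" and g: "\<And>n. g n \<in> S" "g \<longlonglongrightarrow> y"
    by (auto simp: closure_sequential)
  have "(\<lambda>n. f n + g n) \<longlonglongrightarrow> x + y" using f g by (intro tendsto_add)
  then show "x + y \<in> closure S"
    using f g complex_vector.subspace_add[OF S]
    by (auto simp: closure_sequential intro!: exI[of _ "\<lambda>n. f n + g n"])
next
  fix c and x :: 'b assume x: "x \<in> closure S"
  show "c *\<^sub>C x \<in> closure S"
    unfolding closure_approachable
  proof (intro allI impI)
    fix \<epsilon> :: real assume \<epsilon>: "\<epsilon> > 0"
    then have "\<epsilon> / (cmod c + 1) > 0" by (simp add: add_nonneg_pos)
    then obtain y where y: "y \<in> S" "dist y x < \<epsilon> / (cmod c + 1)"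
      using x unfolding closure_approachable by blast
    have "dist (c *\<^sub>C y) (c *\<^sub>C x) = cmod c * dist y x"
      by (simp add: dist_norm norm_scaleC flip: complex_vector.scale_right_diff_distrib)
    also have "\<dots> \<le> (cmod c + 1) * dist y x" by (intro mult_right_mono) auto
    also have "\<dots> < (cmod c + 1) * (\<epsilon> / (cmod c + 1))"
      using y(2) by (intro mult_strict_left_mono) (simp_all add: add_nonneg_pos)
    also have "\<dots> = \<epsilon>" by (simp add: add_nonneg_eq_0_iff)
    finally show "\<exists>y\<in>S. dist y (c *\<^sub>C x) < \<epsilon>"
      using y(1) complex_vector.subspace_scale[OF S] by blast
  qed
qed

locale representation =
  fixes A :: "'b::cstar_algebra set" and \<pi> :: "'b \<Rightarrow> 'h::chilbert_space \<Rightarrow>\<^sub>L 'h"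
  assumes alg: "subalgebra A" and closed_A: "closed A" and rep: "continuous_representation A \<pi>"
begin

lemma A_sub: "complex_vector.subspace A" and A_mult: "a \<in> A \<Longrightarrow> b \<in> A \<Longrightarrow> a * b \<in> A"
  using alg by (auto simp: subalgebra_def)

lemma rep_facts:
  "a \<in> A \<Longrightarrow> \<pi> a (c *\<^sub>C h) = c *\<^sub>C \<pi> a h"
  "a \<in> A \<Longrightarrow> b \<in> A \<Longrightarrow> \<pi> (a + b) = \<pi> a + \<pi> b"
  "a \<in> A \<Longrightarrow> \<pi> (c *\<^sub>C a) h = c *\<^sub>C \<pi> a h"
  "a \<in> A \<Longrightarrow> b \<in> A \<Longrightarrow> \<pi> (a * b) = \<pi> a o\<^sub>L \<pi> b"
  "continuous_on A \<pi>"
  using rep by (auto simp: continuous_representation_def)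

lemma rep_scaleR: "a \<in> A \<Longrightarrow> \<pi> (r *\<^sub>R a) = r *\<^sub>R \<pi> a"
  by (rule blinfun_eqI) (simp add: scaleR_scaleC rep_facts(3) blinfun.scaleR_left)

lemma rep_zero: "\<pi> 0 = 0"
  using rep_facts(2)[of 0 0] complex_vector.subspace_0[OF A_sub] by simp

lemma rep_diff: "a \<in> A \<Longrightarrow> b \<in> A \<Longrightarrow> \<pi> (a - b) = \<pi> a - \<pi> b"
  using rep_facts(2)[of "a - b" b] complex_vector.subspace_diff[OF A_sub, of a b] by simp

lemma rep_bounded: obtains C where "C > 0" "\<And>a. a \<in> A \<Longrightarrow> norm (\<pi> a) \<le> C * norm a"
proof -
  have "0 \<in> A" by (rule complex_vector.subspace_0[OF A_sub])
  then obtain \<delta> where \<delta>: "\<delta> > 0" "\<And>a. a \<in> A \<Longrightarrow> dist a 0 < \<delta> \<Longrightarrow> dist (\<pi> a) (\<pi> 0) < 1"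
    using rep_facts(5) zero_less_one unfolding continuous_on_iff by metis
  have "norm (\<pi> a) \<le> 2 / \<delta> * norm a" if a: "a \<in> A" for a
  proof (cases "a = 0")
    case False
    let ?r = "\<delta> / (2 * norm a)"
    have r: "?r > 0" using \<delta> False by simp
    have "?r *\<^sub>R a \<in> A" using complex_vector.subspace_scale[OF A_sub a] by (simp add: scaleR_scaleC)
    moreover have "dist (?r *\<^sub>R a) 0 < \<delta>" using \<delta>(1) False by simp
    ultimately have "norm (\<pi> (?r *\<^sub>R a)) < 1" using \<delta>(2) rep_zero by fastforce
    then have "?r * norm (\<pi> a) < 1" using r \<delta>(1) by (simp add: rep_scaleR a)
    then show ?thesis using \<delta>(1) False by (simp add: field_simps)
  qed (simp add: rep_zero)
  then show ?thesis using that[of "2 / \<delta>"] \<delta>(1) by simp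
qed

lemma rep_kernel_closed_ideal: "closed_ideal A (rep_kernel A \<pi>)"
proof -
  have "rep_kernel A \<pi> = A \<inter> \<pi> -` {0}" by (auto simp: rep_kernel_def)
  then have "closed (rep_kernel A \<pi>)"
    using continuous_closed_preimage[OF rep_facts(5) closed_A, of "{0}"] by simp
  moreover have "complex_vector.subspace (rep_kernel A \<pi>)"
  proof (rule complex_vector.subspaceI)
    show "0 \<in> rep_kernel A \<pi>" using complex_vector.subspace_0[OF A_sub] by (simp add: rep_kernel_def rep_zero)
  next
    fix a b assume "a \<in> rep_kernel A \<pi>" "b \<in> rep_kernel A \<pi>"
    then show "a + b \<in> rep_kernel A \<pi>"
      using complex_vector.subspace_add[OF A_sub] by (simp add: rep_kernel_def rep_facts(2))
  next
    fix c a assume a: "a \<in> rep_kernel A \<pi>"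
    then have "\<pi> (c *\<^sub>C a) = 0"
      by (intro blinfun_eqI) (simp add: rep_kernel_def rep_facts(3))
    then show "c *\<^sub>C a \<in> rep_kernel A \<pi>"
      using a complex_vector.subspace_scale[OF A_sub] by (simp add: rep_kernel_def)
  qed
  moreover have "a * x \<in> rep_kernel A \<pi> \<and> x * a \<in> rep_kernel A \<pi>" if "a \<in> A" "x \<in> rep_kernel A \<pi>" for a x
    using that A_mult by (auto simp: rep_kernel_def rep_facts(4) intro: blinfun_eqI)
  ultimately show ?thesis by (auto simp: closed_ideal_def rep_kernel_def)
qed

definition cyclic_subspace :: "'b \<Rightarrow> 'h set" where
  "cyclic_subspace e = closure (complex_vector.span {\<pi> (x * e) h | x h. x \<in> A})"

lemma cyclic_subspace_Lat:
  assumes e: "e \<in> A" shows "cyclic_subspace e \<in> Lat (\<pi> ` A)"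
proof -
  let ?G = "{\<pi> (x * e) h | x h. x \<in> A}"
  have sub: "complex_vector.subspace (cyclic_subspace e)"
    unfolding cyclic_subspace_def
    by (rule closure_complex_subspace[OF complex_vector.subspace_span])
  have "\<pi> a ` cyclic_subspace e \<subseteq> cyclic_subspace e" if a: "a \<in> A" for a
    unfolding cyclic_subspace_def
  proof (rule image_closure_subset)
    show "continuous_on (closure (complex_vector.span ?G)) (\<pi> a)"
      by (intro continuous_intros)
    have "\<pi> a v \<in> complex_vector.span ?G" if "v \<in> complex_vector.span ?G" for v
      using that
    proof (induction rule: complex_vector.span_induct)
      case base
      show ?case
        by (rule complex_vector.subspaceI)
          (auto simp: blinfun.add_right rep_facts(1)[OF a] blinfun.zero_right complex_vector.span_zero
            complex_vector.span_add complex_vector.span_scale)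
    next
      case (step v)
      then obtain x h where x: "x \<in> A" "v = \<pi> (x * e) h" by blast
      have "\<pi> a v = \<pi> (a * x * e) h"
        using x a e A_mult by (simp add: rep_facts(4) mult.assoc)
      then have "\<pi> a v \<in> ?G" using A_mult[OF a x(1)] by blast
      then show ?case by (rule complex_vector.span_base)
    qed
    then show "\<pi> a ` complex_vector.span ?G \<subseteq> closure (complex_vector.span ?G)"
      using closure_subset by blast
  qed simp
  then show ?thesis using sub by (auto simp: Lat_def cyclic_subspace_def)
qed

end

section \<open>Kernels of nest representations\<close>

text \<open>
  On the level \<open>j\<close>, the projection \<open>R j\<close> collects the rows in which \<open>f\<close> has an entry outside the
  kernel, so that \<open>\<pi> (R j)\<close> fixes the range of \<open>\<pi> f\<close>. If an entry \<open>g\<close> of \<open>R j * x * e\<close>, which belongs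
  to \<open>J\<close>, is outside the kernel, then its row also contains an entry \<open>u\<close> of \<open>f\<close>, which belongs to \<open>K\<close>,
  outside the kernel. The columns of \<open>g\<close> and \<open>u\<close> are comparable, so one of the two is, up to a scalar,
  the product of the other with an element of \<open>A\<close> and belongs to \<open>J \<inter> K\<close>, a contradiction. Hence
  \<open>\<pi> (R j)\<close> annihilates \<open>\<pi> (x * e) h\<close> for large \<open>j\<close>; as its norm is bounded independently of \<open>j\<close>, a
  nonzero vector in the range of \<open>\<pi> f\<close> keeps its distance from the span of these vectors.
\<close>

lemma (in AF_frame) range_not_in_cyclic_subspace:
  fixes \<pi> :: "'b \<Rightarrow> 'h::chilbert_space \<Rightarrow>\<^sub>L 'h"
  assumes A: "TAF_algebra D A" "strongly_maximal Bs D A" and rep: "continuous_representation A \<pi>"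
    and J: "closed_ideal A J" and K: "closed_ideal A K" and JK: "rep_kernel A \<pi> = J \<inter> K"
    and e: "e \<in> J \<inter> Bs i" and f: "f \<in> K \<inter> Bs i" "f \<notin> rep_kernel A \<pi>"
  shows "\<not> range (\<pi> f) \<subseteq> representation.cyclic_subspace A \<pi> e"
proof
  interpret representation A \<pi>
    using A rep by unfold_locales (auto simp: TAF_algebra_def triangular_def)
  assume range: "range (\<pi> f) \<subseteq> cyclic_subspace e"
  let ?I = "rep_kernel A \<pi>"
  have DA: "D \<subseteq> A" using A by (auto simp: TAF_algebra_def triangular_def)
  have J': "J \<subseteq> A" "complex_vector.subspace J" "\<And>a x. a \<in> A \<Longrightarrow> x \<in> J \<Longrightarrow> a * x \<in> J"
    "\<And>a x. a \<in> A \<Longrightarrow> x \<in> J \<Longrightarrow> x * a \<in> J"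
    using J by (auto simp: closed_ideal_def)
  have K': "K \<subseteq> A" "complex_vector.subspace K" "\<And>a x. a \<in> A \<Longrightarrow> x \<in> K \<Longrightarrow> a * x \<in> K"
    "\<And>a x. a \<in> A \<Longrightarrow> x \<in> K \<Longrightarrow> x * a \<in> K"
    using K by (auto simp: closed_ideal_def)
  have I_sub: "complex_vector.subspace ?I"
    using rep_kernel_closed_ideal by (simp add: closed_ideal_def)
  have eA: "e \<in> A" and fA: "f \<in> A" using e f J'(1) K'(1) by auto
  have A_bim: "closed_bimodule D A"
    using A_sub closed_A A_mult DA by (auto simp: closed_bimodule_def)
  define rows where "rows j = {p\<in>P j. \<exists>s\<in>P j. p * f * s \<notin> ?I}" for j
  define R where "R j = \<Sum>(rows j)" for j
  have R_D: "R j \<in> D \<inter> Bs j" for j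
  proof -
    interpret j: diagonal_frame "Bs j" "D \<inter> Bs j" "P j" by (rule frame)
    show ?thesis unfolding R_def
      by (rule complex_vector.subspace_sum[OF j.D_closed(1)]) (use j.P_facts(4) in \<open>auto simp: rows_def\<close>)
  qed
  have RA: "R j \<in> A" for j using R_D DA by blast
  have R_norm: "norm (R j) \<le> 1" for j
  proof -
    interpret j: diagonal_frame "Bs j" "D \<inter> Bs j" "P j" by (rule frame)
    show ?thesis unfolding R_def
      by (intro norm_projection_le_1 projection_sum_orthogonal orthogonal_projections_subset[OF j.orthogonal])
        (auto simp: rows_def)
  qed
  have R_f: "\<pi> (R j) (\<pi> f h) = \<pi> f h" if j: "i \<le> j" for j h
  proof -
    interpret j: diagonal_frame "Bs j" "D \<inter> Bs j" "P j" by (rule frame)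
    have fB: "f \<in> Bs j" using f Bs_mono[OF j] by blast
    have "f = (\<Sum>p\<in>P j. p * f)" by (rule j.expand_left[OF fB])
    also have "\<dots> = (\<Sum>p\<in>P j - rows j. p * f) + (\<Sum>p\<in>rows j. p * f)"
      by (intro sum.subset_diff j.finite_P) (auto simp: rows_def)
    finally have "f - R j * f = (\<Sum>p\<in>P j - rows j. p * f)"
      unfolding R_def sum_distrib_right by (rule iffD2[OF diff_eq_eq])
    also have "\<dots> = (\<Sum>p\<in>P j - rows j. \<Sum>s\<in>P j. p * f * s)"
      by (intro sum.cong refl j.expand_right j.B_closed(3) fB) (auto intro: j.P_facts(5))
    also have "\<dots> \<in> ?I" by (intro complex_vector.subspace_sum[OF I_sub]) (auto simp: rows_def)
    finally have "\<pi> (f - R j * f) = 0" by (simp add: rep_kernel_def)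
    then have "\<pi> f = \<pi> (R j) o\<^sub>L \<pi> f"
      using rep_diff[OF fA A_mult[OF RA fA]] by (simp add: rep_facts(4) RA fA)
    then show ?thesis by (metis blinfun_apply_blinfun_compose)
  qed
  have R_e: "R j * (x * e) \<in> ?I" if x: "x \<in> A" "x \<in> Bs j" and j: "i \<le> j" for j x
  proof -
    interpret j: diagonal_frame "Bs j" "D \<inter> Bs j" "P j" by (rule frame)
    have eB: "e \<in> Bs j" using e Bs_mono[OF j] by blast
    have fB: "f \<in> Bs j" using f Bs_mono[OF j] by blast
    have PA: "p \<in> A" if "p \<in> P j" for p using j.P_facts(4)[OF that] DA by blast
    have max: "maximal_triangular (Bs j) (D \<inter> Bs j) (A \<inter> Bs j)"
      using A(2) by (simp add: strongly_maximal_def)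
    have entry: "p * x * e * q \<in> ?I" if p: "p \<in> rows j" and q: "q \<in> P j" for p q
    proof (rule ccontr)
      let ?g = "p * x * e * q"
      assume gI: "?g \<notin> ?I"
      have pP: "p \<in> P j" using p by (simp add: rows_def)
      obtain s where s: "s \<in> P j" and uI: "p * f * s \<notin> ?I" using p by (auto simp: rows_def)
      let ?u = "p * f * s"
      have gJ: "?g \<in> J" by (intro J'(4)[OF PA[OF q]] J'(3) A_mult PA pP x) (use e in simp)
      have uK: "?u \<in> K" by (intro K'(4)[OF PA[OF s]] K'(3) PA pP) (use f in simp)
      have gB: "?g \<in> Bs j" by (intro j.B_closed(3) j.P_facts(5) pP q x eB)
      have uB: "?u \<in> Bs j" by (intro j.B_closed(3) j.P_facts(5) pP s fB)
      have g: "p * ?g = ?g" "?g * q = ?g" and u: "p * ?u = ?u" "?u * s = ?u"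
        using j.P_facts(1) pP q s by (simp_all add: mult.assoc) (simp_all flip: mult.assoc)
      have "0 \<in> ?I" by (rule complex_vector.subspace_0[OF I_sub])
      then have g0: "?g \<noteq> 0" and u0: "?u \<noteq> 0" using gI uI by auto
      obtain a where a: "a > 0" "?g * adj ?g = a *\<^sub>R p"
        using j.entry_square[OF gB g g0 pP q] by blast
      obtain b where b: "b > 0" "?u * adj ?u = b *\<^sub>R p"
        using j.entry_square[OF uB u u0 pP s] by blast
      let ?y = "adj ?g * ?u"
      have yB: "?y \<in> Bs j" by (intro j.B_closed(3,7) gB uB)
      have qg: "q * adj ?g = adj ?g" using g(2) j.P_facts(2)[OF q] by (metis adj_mult)
      have y: "q * ?y = ?y" using qg by (simp flip: mult.assoc)
      have ys: "?y * s = ?y" using u(2) by (simp add: mult.assoc)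
      have unscale: "z \<in> S" if S: "complex_vector.subspace S" and "r > 0" "r *\<^sub>R z \<in> S" for r z S
      proof -
        have "complex_of_real (1 / r) *\<^sub>C (r *\<^sub>R z) \<in> S" by (rule complex_vector.subspace_scale[OF S that(3)])
        then show ?thesis using \<open>r > 0\<close> by (simp add: scaleC_of_real del: of_real_divide)
      qed
      from j.maximal_triangular_comparable[OF max q s yB y ys] show False
      proof
        assume "?y \<in> A \<inter> Bs j"
        then have "?g * ?y \<in> J" using J'(4) gJ by blast
        moreover have "?g * ?y = a *\<^sub>R ?u"
        proof -
          have "?g * ?y = (?g * adj ?g) * ?u" by (simp only: mult.assoc)
          then show ?thesis unfolding a(2) using u(1) by simp
        qed
        ultimately have "?u \<in> J" using unscale[OF J'(2) a(1)] by simp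
        then show False using uK uI JK by blast
      next
        assume "adj ?y \<in> A \<inter> Bs j"
        then have "?u * adj ?y \<in> K" using K'(4) uK by blast
        moreover have "?u * adj ?y = b *\<^sub>R ?g"
        proof -
          have "adj ?y = adj ?u * ?g" unfolding adj_mult[of "adj ?g"] adj_adj ..
          then have "?u * adj ?y = (?u * adj ?u) * ?g" by (simp only: mult.assoc)
          then show ?thesis unfolding b(2) using g(1) by simp
        qed
        ultimately have "?g \<in> K" using unscale[OF K'(2) b(1)] by simp
        then show False using gJ gI JK by blast
      qed
    qed
    have "R j * (x * e) = (\<Sum>p\<in>rows j. p * x * e)" by (simp add: R_def sum_distrib_right mult.assoc)
    also have "\<dots> = (\<Sum>p\<in>rows j. \<Sum>q\<in>P j. p * x * e * q)"
      by (intro sum.cong refl j.expand_right j.B_closed(3) x(2) eB) (auto simp: rows_def intro: j.P_facts(5))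
    also have "\<dots> \<in> ?I" by (intro complex_vector.subspace_sum[OF I_sub] entry)
    finally show ?thesis .
  qed
  obtain C where C: "C > 0" "\<And>a. a \<in> A \<Longrightarrow> norm (\<pi> a) \<le> C * norm a" using rep_bounded by blast
  let ?G = "{\<pi> (x * e) h | x h. x \<in> A \<inter> (\<Union>j. Bs j)}"
  have ev: "eventually (\<lambda>j. \<pi> (R j) v = 0) sequentially" if "v \<in> complex_vector.span ?G" for v
    using that
  proof (induction rule: complex_vector.span_induct)
    case base
    show ?case
    proof (rule complex_vector.subspaceI)
      fix v w assume "v \<in> {v. eventually (\<lambda>j. \<pi> (R j) v = 0) sequentially}"
        "w \<in> {v. eventually (\<lambda>j. \<pi> (R j) v = 0) sequentially}"
      then show "v + w \<in> {v. eventually (\<lambda>j. \<pi> (R j) v = 0) sequentially}"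
        by (auto simp: blinfun.add_right elim: eventually_elim2)
    qed (auto simp: blinfun.zero_right rep_facts(1)[OF RA] elim: eventually_mono)
  next
    case (step v)
    then obtain x h k where x: "x \<in> A" "x \<in> Bs k" "v = \<pi> (x * e) h" by blast
    show ?case
      unfolding eventually_sequentially
    proof (intro exI[of _ "max i k"] allI impI)
      fix j assume j: "max i k \<le> j"
      then have "R j * (x * e) \<in> ?I" using R_e[of x j] x Bs_mono[of k j] by auto
      then have "\<pi> (R j) o\<^sub>L \<pi> (x * e) = 0"
        using rep_facts(4)[OF RA A_mult[OF x(1) eA]] by (simp add: rep_kernel_def)
      then show "\<pi> (R j) v = 0" unfolding x(3) by (metis blinfun_apply_blinfun_compose zero_blinfun.rep_eq)
    qed
  qed
  have dense: "cyclic_subspace e \<subseteq> closure (complex_vector.span ?G)"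
    unfolding cyclic_subspace_def
  proof (rule closure_minimal[OF _ closed_closure], rule complex_vector.span_minimal)
    show "complex_vector.subspace (closure (complex_vector.span ?G))"
      by (rule closure_complex_subspace[OF complex_vector.subspace_span])
    show "{\<pi> (x * e) h | x h. x \<in> A} \<subseteq> closure (complex_vector.span ?G)"
    proof
      fix v assume "v \<in> {\<pi> (x * e) h | x h. x \<in> A}"
      then obtain x h where x: "x \<in> A" "v = \<pi> (x * e) h" by blast
      show "v \<in> closure (complex_vector.span ?G)"
        unfolding closure_approachable
      proof (intro allI impI)
        fix \<epsilon> :: real assume \<epsilon>: "\<epsilon> > 0"
        let ?k = "C * norm e * norm h + 1"
        have k: "?k > 0" using C(1) by (simp add: add_nonneg_pos)
        obtain m z where z: "z \<in> A \<inter> Bs m" "norm (z - x) < \<epsilon> / ?k"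
          using closed_bimodule_inductive[OF A_bim x(1)] \<epsilon> k by (metis divide_pos_pos)
        have zx: "z - x \<in> A" using z x complex_vector.subspace_diff[OF A_sub] by blast
        have "\<pi> (z * e) h - v = \<pi> ((z - x) * e) h"
          using rep_diff[of "z * e" "x * e"] z x eA A_mult
          by (simp add: left_diff_distrib blinfun.diff_left)
        then have "norm (\<pi> (z * e) h - v) \<le> norm (\<pi> ((z - x) * e)) * norm h"
          by (simp add: norm_blinfun)
        also have "\<dots> \<le> (C * (norm (z - x) * norm e)) * norm h"
          by (intro mult_right_mono order_trans[OF C(2)[OF A_mult[OF zx eA]]] mult_left_mono norm_mult_ineq)
            (use C(1) in auto)
        also have "\<dots> = norm (z - x) * (C * norm e * norm h)" by simp
        also have "\<dots> \<le> norm (z - x) * ?k" by (intro mult_left_mono) auto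
        also have "\<dots> < \<epsilon> / ?k * ?k" by (rule mult_strict_right_mono[OF z(2) k])
        also have "\<dots> = \<epsilon>" using k by simp
        finally have "dist (\<pi> (z * e) h) v < \<epsilon>" by (simp add: dist_norm)
        moreover have "\<pi> (z * e) h \<in> complex_vector.span ?G"
          by (rule complex_vector.span_base) (use z in blast)
        ultimately show "\<exists>w\<in>complex_vector.span ?G. dist w v < \<epsilon>" by (rule bexI)
      qed
    qed
  qed
  have "\<pi> f \<noteq> 0" using f fA by (simp add: rep_kernel_def)
  then obtain h where h: "\<pi> f h \<noteq> 0" by (metis blinfun_eqI zero_blinfun.rep_eq)
  have "\<pi> f h \<in> closure (complex_vector.span ?G)" using range dense by blast
  moreover have "norm (\<pi> f h) / C > 0" using h C(1) by simp
  ultimately obtain v where v: "v \<in> complex_vector.span ?G" "dist v (\<pi> f h) < norm (\<pi> f h) / C"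
    unfolding closure_approachable by blast
  obtain k where k: "\<And>j. k \<le> j \<Longrightarrow> \<pi> (R j) v = 0"
    using ev[OF v(1)] by (auto simp: eventually_sequentially)
  let ?j = "max i k"
  have "\<pi> f h = \<pi> (R ?j) (\<pi> f h - v)" using k[of ?j] R_f[of ?j] by (simp add: blinfun.diff_right)
  then have "norm (\<pi> f h) \<le> norm (\<pi> (R ?j)) * norm (\<pi> f h - v)" by (metis norm_blinfun)
  also have "\<dots> \<le> C * norm (\<pi> f h - v)"
  proof (rule mult_right_mono)
    have "norm (\<pi> (R ?j)) \<le> C * norm (R ?j)" by (rule C(2)[OF RA])
    also have "\<dots> \<le> C" using R_norm[of ?j] C(1) by simp
    finally show "norm (\<pi> (R ?j)) \<le> C" .
  qed simp
  also have "\<dots> < norm (\<pi> f h)"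
    using v(2) C(1) by (simp add: dist_norm norm_minus_commute field_simps)
  finally show False by simp
qed

theorem theorem2p2:
  fixes Bs :: "nat \<Rightarrow> 'b::cstar_algebra set"
    and D A :: "'b set"
    and \<pi> :: "'b \<Rightarrow> 'h::chilbert_space \<Rightarrow>\<^sub>L 'h"
  assumes "AF_canonical_masa Bs D"
    and "cantor_space (spectrum_topology D)"
    and "TAF_algebra D A"
    and "strongly_maximal Bs D A"
    and "simple_cstar TYPE('b)"
    and "totally_ordered_spectrum D A"
    and "nest_representation A \<pi>"
  shows "meet_irreducible A (rep_kernel A \<pi>)"
proof -
  obtain P where "AF_frame Bs D P" using AF_canonical_masa_frame[OF assms(1)] .
  then interpret AF_frame Bs D P .
  have rep: "continuous_representation A \<pi>"
    and nest: "\<And>M N. M \<in> Lat (\<pi> ` A) \<Longrightarrow> N \<in> Lat (\<pi> ` A) \<Longrightarrow> M \<subseteq> N \<or> N \<subseteq> M"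
    using assms(7) by (auto simp: nest_representation_def)
  interpret representation A \<pi>
    using assms(3) rep by unfold_locales (auto simp: TAF_algebra_def triangular_def)
  let ?I = "rep_kernel A \<pi>"
  have DA: "D \<subseteq> A" using assms(3) by (auto simp: TAF_algebra_def triangular_def)
  have entry: "\<exists>m. \<exists>e\<in>J \<inter> Bs m. e \<notin> ?I" if J: "closed_ideal A J" and not_le: "\<not> J \<subseteq> ?I" for J
  proof (rule ccontr)
    assume no: "\<nexists>m. \<exists>e\<in>J \<inter> Bs m. e \<notin> ?I"
    have bim: "closed_bimodule D J"
      using J DA by (auto simp: closed_ideal_def closed_bimodule_def)
    have "a \<in> closure ?I" if a: "a \<in> J" for a
      unfolding closure_approachable
    proof (intro allI impI)
      fix \<epsilon> :: real assume "\<epsilon> > 0"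
      then obtain m s where s: "s \<in> J \<inter> Bs m" "norm (s - a) < \<epsilon>"
        using closed_bimodule_inductive[OF bim a] by blast
      then have "s \<in> ?I" using no by blast
      then show "\<exists>s\<in>?I. dist s a < \<epsilon>" using s(2) by (auto simp: dist_norm)
    qed
    moreover have "closed ?I" using rep_kernel_closed_ideal by (simp add: closed_ideal_def)
    ultimately show False using not_le by auto
  qed
  have range: "range (\<pi> f) \<subseteq> cyclic_subspace f" if f: "f \<in> A" "f \<in> Bs m" for f m
  proof -
    interpret m: diagonal_frame "Bs m" "D \<inter> Bs m" "P m" by (rule frame)
    have "\<pi> f h = \<pi> (\<Sum>(P m) * f) h" for h using m.unit_left[OF f(2)] by simp
    then have "\<pi> f h \<in> {\<pi> (x * f) h | x h. x \<in> A}" for h using m.unit_in_D DA by blast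
    then have "\<pi> f h \<in> complex_vector.span {\<pi> (x * f) h | x h. x \<in> A}" for h
      by (rule complex_vector.span_base)
    then show ?thesis unfolding cyclic_subspace_def using closure_subset by blast
  qed
  have "?I = J \<or> ?I = K"
    if J: "closed_ideal A J" and K: "closed_ideal A K" and JK: "?I = J \<inter> K" for J K
  proof (rule ccontr)
    assume "\<not> (?I = J \<or> ?I = K)"
    then have "\<not> J \<subseteq> ?I" "\<not> K \<subseteq> ?I" using JK by blast+
    then obtain m e n f where e: "e \<in> J" "e \<in> Bs m" "e \<notin> ?I" and f: "f \<in> K" "f \<in> Bs n" "f \<notin> ?I"
      using entry[OF J] entry[OF K] by blast
    define i where "i = max m n"
    have B: "e \<in> Bs i" "f \<in> Bs i" using e f Bs_mono[of m i] Bs_mono[of n i] by (auto simp: i_def)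
    have A: "e \<in> A" "f \<in> A" using e f J K by (auto simp: closed_ideal_def)
    have KJ: "?I = K \<inter> J" using JK by blast
    have "\<not> range (\<pi> f) \<subseteq> cyclic_subspace e"
      by (rule range_not_in_cyclic_subspace[OF assms(3,4) rep J K JK, where i = i]) (use e f B in auto)
    moreover have "\<not> range (\<pi> e) \<subseteq> cyclic_subspace f"
      by (rule range_not_in_cyclic_subspace[OF assms(3,4) rep K J KJ, where i = i]) (use e f B in auto)
    moreover have "cyclic_subspace e \<subseteq> cyclic_subspace f \<or> cyclic_subspace f \<subseteq> cyclic_subspace e"
      by (intro nest cyclic_subspace_Lat A)
    ultimately show False using range[OF A(1) B(1)] range[OF A(2) B(2)] by blast
  qed
  then show ?thesis using rep_kernel_closed_ideal by (auto simp: meet_irreducible_def)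
qed

end
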